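(* Let $p$ and $q$ be distinct primes with $pq\neq 6$, $q\neq 2$ and $q\mid p-1$, and let $n\in\{2,3,\dots,\frac{q-1}{2}\}$. Let $r$ be an integer with $r^{q}\equiv 1 \pmod{p}$ and $r\not\equiv 1\pmod{p}$, and let $G=\langle a,b,c\mid a^{q^{2}}=b^{p}=c^{p}=[b,c]=1,\ a^{-1}ba=b^{r},\ a^{-1}ca=c^{r^{n}}\rangle$. Then $\mathrm{Aut}(G)\simeq(\mathbb{Z}_{p}\times\mathbb{Z}_{p})\rtimes((\mathbb{Z}_{p-1}\times\mathbb{Z}_{p-1})\rtimes\mathbb{Z}_{q})$.
   Context: $\mathbb{Z}_n$ is the cyclic group of order $n$; $[x,y]=x^{-1}y^{-1}xy$. $X\rtimes Y$ denotes a semidirect product with normal subgroup $X$ with respect to some homomorphism $Y\to\mathrm{Aut}(X)$ (possibly trivial); the statement asserts that $\mathrm{Aut}(G)$ is isomorphic to such an (iterated) semidirect product for some choice of actions. *)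

theory Defs
  imports "HOL-Algebra.Bij" "HOL-Algebra.Elementary_Groups" "HOL-Number_Theory.Cong"
    "HOL-Computational_Algebra.Primes"
begin

section \<open>Group presentations\<close>

text \<open>
  A word over the generators \<open>'g\<close>: the letter \<open>(x, True)\<close> stands for \<open>x\<close> and
  \<open>(x, False)\<close> for the inverse of \<open>x\<close>.
\<close>

type_synonym 'g word = "('g \<times> bool) list"

definition gen :: "'g \<Rightarrow> 'g word" where
  "gen x = [(x, True)]"

definition winv :: "'g word \<Rightarrow> 'g word" where
  "winv w = rev (map (\<lambda>(x, e). (x, \<not> e)) w)"

definition wpow :: "'g word \<Rightarrow> int \<Rightarrow> 'g word" where
  "wpow w k = (if k \<ge> 0 then concat (replicate (nat k) w)
               else concat (replicate (nat (- k)) (winv w)))"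

definition wcomm :: "'g word \<Rightarrow> 'g word \<Rightarrow> 'g word" where
  "wcomm u v = winv u @ winv v @ u @ v"

text \<open>
  Equality of words in the group presented by the relations \<open>u = v\<close>, \<open>(u, v) \<in> R\<close>:
  the least congruence on words that makes \<open>(x, e)\<close> and \<open>(x, \<not> e)\<close> mutually inverse
  and contains \<open>R\<close>.
\<close>

inductive pres_eq :: "('g word \<times> 'g word) set \<Rightarrow> 'g word \<Rightarrow> 'g word \<Rightarrow> bool"
  for R :: "('g word \<times> 'g word) set" where
  refl: "pres_eq R w w"
| sym: "pres_eq R u v \<Longrightarrow> pres_eq R v u"
| trans: "pres_eq R u v \<Longrightarrow> pres_eq R v w \<Longrightarrow> pres_eq R u w"
| append: "pres_eq R u u' \<Longrightarrow> pres_eq R v v' \<Longrightarrow> pres_eq R (u @ v) (u' @ v')"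
| cancel: "pres_eq R [(x, e), (x, \<not> e)] []"
| rel: "(u, v) \<in> R \<Longrightarrow> pres_eq R u v"

definition pres_class :: "('g word \<times> 'g word) set \<Rightarrow> 'g word \<Rightarrow> 'g word set" where
  "pres_class R w = {v. pres_eq R w v}"

definition presented_group :: "('g word \<times> 'g word) set \<Rightarrow> 'g word set monoid" where
  "presented_group R =
    \<lparr>carrier = range (pres_class R),
     monoid.mult = (\<lambda>X Y. {w. \<exists>u\<in>X. \<exists>v\<in>Y. pres_eq R (u @ v) w}),
     one = pres_class R []\<rparr>"

lemma pres_class_eq_iff: "pres_class R u = pres_class R v \<longleftrightarrow> pres_eq R u v"
  unfolding pres_class_def by (blast intro: pres_eq.refl pres_eq.sym pres_eq.trans)

lemma presented_group_mult:
  "pres_class R u \<otimes>\<^bsub>presented_group R\<^esub> pres_class R v = pres_class R (u @ v)"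
  unfolding presented_group_def pres_class_def
  by (auto intro: pres_eq.refl pres_eq.sym pres_eq.trans pres_eq.append)

lemma presented_group_carrier: "carrier (presented_group R) = range (pres_class R)"
  by (simp add: presented_group_def)

lemma presented_group_one: "\<one>\<^bsub>presented_group R\<^esub> = pres_class R []"
  by (simp add: presented_group_def)

lemma winv_Cons: "winv ((x, e) # w) = winv w @ [(x, \<not> e)]"
  by (simp add: winv_def)

lemma pres_eq_winv: "pres_eq R (winv w @ w) []"
proof (induction w)
  case Nil
  show ?case by (simp add: winv_def pres_eq.refl)
next
  case (Cons l w)
  obtain x e where l: "l = (x, e)" by (cases l)
  have "pres_eq R ([(x, \<not> e), (x, e)] @ w) ([] @ w)"
    using pres_eq.cancel[of R x "\<not> e"] by (intro pres_eq.append pres_eq.refl) simp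
  hence "pres_eq R (winv w @ [(x, \<not> e), (x, e)] @ w) (winv w @ w)"
    by (intro pres_eq.append pres_eq.refl) simp
  thus ?case using Cons.IH by (auto simp: l winv_Cons intro: pres_eq.trans)
qed

lemma group_presented_group: "group (presented_group R)"
proof (rule groupI)
  fix X assume "X \<in> carrier (presented_group R)"
  then obtain w where "X = pres_class R w" by (auto simp: presented_group_carrier)
  thus "\<exists>Y\<in>carrier (presented_group R). Y \<otimes>\<^bsub>presented_group R\<^esub> X = \<one>\<^bsub>presented_group R\<^esub>"
    using pres_eq_winv[of R w]
    by (auto simp: presented_group_carrier presented_group_mult presented_group_one
        pres_class_eq_iff)
qed (auto simp: presented_group_carrier presented_group_mult presented_group_one)

text \<open>The universal property: von Dyck's theorem.\<close>

definition (in group) eval_word :: "('g \<Rightarrow> 'a) \<Rightarrow> 'g word \<Rightarrow> 'a" where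
  "eval_word f w = foldr (\<lambda>(x, e) y. (if e then f x else inv (f x)) \<otimes> y) w \<one>"

lemma (in group) eval_word_closed:
  "(\<And>x. f x \<in> carrier G) \<Longrightarrow> eval_word f w \<in> carrier G"
  by (induction w) (auto simp: eval_word_def)

lemma (in group) eval_word_append:
  assumes "\<And>x. f x \<in> carrier G"
  shows "eval_word f (u @ v) = eval_word f u \<otimes> eval_word f v"
proof (induction u)
  case Nil
  show ?case using eval_word_closed[of f v, OF assms] by (simp add: eval_word_def)
next
  case (Cons l u)
  thus ?case
    using assms eval_word_closed[of f u, OF assms] eval_word_closed[of f v, OF assms]
    by (auto simp: eval_word_def m_assoc split: prod.splits)
qed

lemma (in group) eval_word_pres_eq:
  assumes f: "\<And>x. f x \<in> carrier G"
    and R: "\<And>u v. (u, v) \<in> R \<Longrightarrow> eval_word f u = eval_word f v"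
    and "pres_eq R u v"
  shows "eval_word f u = eval_word f v"
  using assms(3)
proof induction
  case (cancel x e)
  show ?case using f[of x] by (auto simp: eval_word_def)
qed (simp_all add: eval_word_append f R)

lemma (in group) presented_group_universal:
  fixes f :: "'g \<Rightarrow> 'a" and R :: "('g word \<times> 'g word) set"
  assumes f: "\<And>x. f x \<in> carrier G"
    and R: "\<And>u v. (u, v) \<in> R \<Longrightarrow> eval_word f u = eval_word f v"
  shows "\<exists>h \<in> hom (presented_group R) G. \<forall>x. h (pres_class R (gen x)) = f x"
proof
  let ?h = "\<lambda>X. eval_word f (SOME w. w \<in> X)"
  have h: "?h (pres_class R w) = eval_word f w" for w
  proof -
    have "(SOME v. v \<in> pres_class R w) \<in> pres_class R w"
      by (rule someI[of _ w]) (simp add: pres_class_def pres_eq.refl)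
    hence "pres_eq R w (SOME v. v \<in> pres_class R w)"
      by (simp add: pres_class_def)
    thus ?thesis using eval_word_pres_eq[OF f R] by metis
  qed
  show "?h \<in> hom (presented_group R) G"
  proof (rule homI)
    fix X assume "X \<in> carrier (presented_group R)"
    then obtain w where "X = pres_class R w" by (auto simp: presented_group_carrier)
    thus "?h X \<in> carrier G" by (simp only: h eval_word_closed[OF f])
  next
    fix X Y assume "X \<in> carrier (presented_group R)" "Y \<in> carrier (presented_group R)"
    then obtain u v where "X = pres_class R u" "Y = pres_class R v"
      by (auto simp: presented_group_carrier)
    thus "?h (X \<otimes>\<^bsub>presented_group R\<^esub> Y) = ?h X \<otimes> ?h Y"
      by (simp only: presented_group_mult h eval_word_append[OF f])
  qed
  show "\<forall>x. ?h (pres_class R (gen x)) = f x"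
    unfolding h using f by (simp add: gen_def eval_word_def)
qed


datatype abc = a | b | c

definition rels :: "nat \<Rightarrow> nat \<Rightarrow> int \<Rightarrow> nat \<Rightarrow> (abc word \<times> abc word) set" where
  "rels p q r n =
    {(wpow (gen a) (int (q ^ 2)), []),
     (wpow (gen b) (int p), []),
     (wpow (gen c) (int p), []),
     (wcomm (gen b) (gen c), []),
     (winv (gen a) @ gen b @ gen a, wpow (gen b) r),
     (winv (gen a) @ gen c @ gen a, wpow (gen c) (r ^ n))}"

hide_const (open) a b c


section \<open>Semidirect products\<close>

text \<open>
  The external semidirect product of \<open>X\<close> (the normal factor) and \<open>Y\<close>, for an action
  \<open>\<phi> \<in> hom Y (AutoGroup X)\<close>.
\<close>

definition semidirect ::
    "('x, 'm) monoid_scheme \<Rightarrow> ('y \<Rightarrow> 'x \<Rightarrow> 'x) \<Rightarrow> ('y, 'n) monoid_scheme \<Rightarrow> ('x \<times> 'y) monoid"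
  where
  "semidirect X \<phi> Y =
    \<lparr>carrier = carrier X \<times> carrier Y,
     monoid.mult = (\<lambda>(x, y) (x', y'). (x \<otimes>\<^bsub>X\<^esub> \<phi> y x', y \<otimes>\<^bsub>Y\<^esub> y')),
     one = (\<one>\<^bsub>X\<^esub>, \<one>\<^bsub>Y\<^esub>)\<rparr>"

lemma group_semidirect:
  assumes "group X" "group Y" and \<phi>: "\<phi> \<in> hom Y (AutoGroup X)"
  shows "group (semidirect X \<phi> Y)"
proof -
  interpret X: group X by fact
  interpret Y: group Y by fact
  have aut: "\<phi> y \<in> auto X" if "y \<in> carrier Y" for y
    using hom_in_carrier[OF \<phi> that] by (simp add: AutoGroup_def)
  have closed: "\<phi> y x \<in> carrier X" if "y \<in> carrier Y" "x \<in> carrier X" for x y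
    using aut[OF that(1)] that(2) by (auto simp: auto_def hom_def)
  have mult: "\<phi> y (x \<otimes>\<^bsub>X\<^esub> x') = \<phi> y x \<otimes>\<^bsub>X\<^esub> \<phi> y x'"
    if "y \<in> carrier Y" "x \<in> carrier X" "x' \<in> carrier X" for x x' y
    using aut[OF that(1)] that(2,3) by (auto simp: auto_def hom_def)
  have act: "\<phi> (y \<otimes>\<^bsub>Y\<^esub> y') x = \<phi> y (\<phi> y' x)"
    if "y \<in> carrier Y" "y' \<in> carrier Y" "x \<in> carrier X" for x y y'
  proof -
    have "\<phi> (y \<otimes>\<^bsub>Y\<^esub> y') = \<phi> y \<otimes>\<^bsub>AutoGroup X\<^esub> \<phi> y'"
      by (rule hom_mult[OF \<phi> that(1,2)])
    also have "\<dots> = compose (carrier X) (\<phi> y) (\<phi> y')"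
      using aut that by (simp add: AutoGroup_def BijGroup_def auto_def)
    finally show ?thesis using that(3) by (simp add: compose_def)
  qed
  have one: "\<phi> \<one>\<^bsub>Y\<^esub> x = x" if "x \<in> carrier X" for x
    using hom_one[OF \<phi> Y.is_group X.AutoGroup] that
    by (simp add: AutoGroup_def BijGroup_def)
  show ?thesis
  proof (rule groupI)
    fix g assume "g \<in> carrier (semidirect X \<phi> Y)"
    then obtain x y where g: "g = (x, y)" "x \<in> carrier X" "y \<in> carrier Y"
      by (auto simp: semidirect_def)
    let ?k = "(\<phi> (inv\<^bsub>Y\<^esub> y) (inv\<^bsub>X\<^esub> x), inv\<^bsub>Y\<^esub> y)"
    have "\<phi> (inv\<^bsub>Y\<^esub> y) (inv\<^bsub>X\<^esub> x) \<otimes>\<^bsub>X\<^esub> \<phi> (inv\<^bsub>Y\<^esub> y) x = \<phi> (inv\<^bsub>Y\<^esub> y) \<one>\<^bsub>X\<^esub>"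
      using g by (simp flip: mult)
    also have "\<dots> = \<one>\<^bsub>X\<^esub>"
      using g mult[of "inv\<^bsub>Y\<^esub> y" "\<one>\<^bsub>X\<^esub>" "\<one>\<^bsub>X\<^esub>"] closed[of "inv\<^bsub>Y\<^esub> y" "\<one>\<^bsub>X\<^esub>"] by simp
    finally have "?k \<otimes>\<^bsub>semidirect X \<phi> Y\<^esub> g = \<one>\<^bsub>semidirect X \<phi> Y\<^esub>"
      using g by (simp add: semidirect_def)
    moreover have "?k \<in> carrier (semidirect X \<phi> Y)"
      using g closed by (simp add: semidirect_def)
    ultimately show "\<exists>k\<in>carrier (semidirect X \<phi> Y).
        k \<otimes>\<^bsub>semidirect X \<phi> Y\<^esub> g = \<one>\<^bsub>semidirect X \<phi> Y\<^esub>" by blast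
  qed (auto simp: semidirect_def closed mult act one X.m_assoc Y.m_assoc)
qed

end

theory Submission
  imports Defs "HOL-Number_Theory.Residue_Primitive_Roots"
begin

text \<open>
  Write \<open>V\<close> for the normal subgroup \<open>\<langle>b, c\<rangle> \<cong> \<int>\<^sub>p \<times> \<int>\<^sub>p\<close> of \<open>G\<close>. The generator \<open>a\<close> acts on \<open>V\<close> by
  conjugation through a diagonal matrix \<open>D = diag (d, d ^ n)\<close> with \<open>d\<close> of order \<open>q\<close>, so \<open>G\<close> is
  the semidirect product of \<open>V\<close> with a cyclic group of order \<open>q\<^sup>2\<close> (\<open>presentation_iso\<close>). The proof
  works in this concrete group \<open>H\<close>, whose elements are pairs \<open>(u, i)\<close> standing for \<open>u a\<^sup>i\<close>.

  Every automorphism is a product of three evident ones: conjugation by some \<open>w \<in> V\<close>, a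
  diagonal matrix acting on \<open>V\<close> and fixing \<open>a\<close>, and a twist \<open>a \<mapsto> a ^ (1 + q t)\<close> fixing \<open>V\<close>. To
  see this, let \<open>f\<close> be an automorphism. The subgroup \<open>V\<close> consists of the elements killed by
  \<open>p\<close>, hence \<open>f\<close> preserves it. If \<open>f a = v a\<^sup>i\<close>, then \<open>f\<close> carries eigenvectors of \<open>D\<close> in \<open>V\<close> to
  eigenvectors of \<open>D ^ i\<close> with the same eigenvalue (\<open>AutoGroup_eigen\<close>). Comparing exponents of
  \<open>d\<close> modulo \<open>q\<close>, the image of \<open>b\<close> has a component along \<open>b\<close> only if \<open>i \<equiv> 1\<close> and one along \<open>c\<close> only
  if \<open>n i \<equiv> 1\<close>, while the image of \<open>c\<close> has a component along \<open>b\<close> only if \<open>i \<equiv> n\<close> and one along \<open>c\<close>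
  only if \<open>i \<equiv> 1\<close>. If \<open>i \<equiv> 1\<close> failed, then \<open>b\<close> and \<open>c\<close> would be exchanged up to scalars and
  \<open>n\<^sup>2 \<equiv> 1\<close>; given \<open>i \<equiv> 1\<close>, a mixed component would force \<open>n \<equiv> 1\<close>. Both are excluded by
  \<open>2 \<le> n \<le> (q - 1) / 2\<close>. So \<open>f\<close> is diagonal on \<open>V\<close> and \<open>i = 1 + q t\<close>. Neither eigenvalue of \<open>D\<close>
  is \<open>1\<close>, so \<open>v = w - D w\<close> for a unique \<open>w\<close>, which says that conjugation by \<open>w\<close> takes \<open>a\<^sup>i\<close> to
  \<open>f a\<close> (\<open>aut_surj\<close>).

  Since \<open>D\<^sup>q = 1\<close>, the twists commute with the other two kinds of automorphisms, and a diagonal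
  matrix \<open>m\<close> turns conjugation by \<open>w\<close> into conjugation by \<open>m w\<close> (\<open>aut_compose\<close>). Hence
  the action of \<open>\<int>\<^sub>q\<close> on \<open>\<int>\<^bsub>p - 1\<^esub> \<times> \<int>\<^bsub>p - 1\<^esub>\<close> may be taken trivial, and that of the whole
  complement on \<open>V\<close> is through diagonal matrices. All units modulo \<open>p\<close> are written as \<open>\<omega> x\<close> for
  a discrete exponential \<open>\<omega>\<close>, which turns every statement about eigenvalues into one about
  exponents modulo \<open>p - 1\<close>.
\<close>

section \<open>Automorphism groups of isomorphic groups\<close>

lemma carrier_AutoGroup_iff:
  "f \<in> carrier (AutoGroup G) \<longleftrightarrow>
    f \<in> extensional (carrier G) \<and> f \<in> hom G G \<and> bij_betw f (carrier G) (carrier G)"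
  by (auto simp: AutoGroup_def auto_def Bij_def)

lemma mult_AutoGroup:
  assumes "f \<in> carrier (AutoGroup G)" "g \<in> carrier (AutoGroup G)"
  shows "f \<otimes>\<^bsub>AutoGroup G\<^esub> g = compose (carrier G) f g"
  using assms by (auto simp: AutoGroup_def auto_def BijGroup_def)

lemma (in group) restrict_iso_in_AutoGroup:
  assumes "f \<in> iso G G"
  shows "restrict f (carrier G) \<in> carrier (AutoGroup G)"
proof -
  have f: "f \<in> hom G G" "bij_betw f (carrier G) (carrier G)"
    using assms by (auto simp: iso_def)
  have "restrict f (carrier G) \<in> hom G G"
    using f(1) by (auto simp: hom_def)
  moreover have "bij_betw (restrict f (carrier G)) (carrier G) (carrier G)"
    using f(2) by (simp cong: bij_betw_cong)
  ultimately show ?thesis by (simp add: carrier_AutoGroup_iff)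
qed

lemma AutoGroup_iso_cong:
  assumes "group G" "group H" "G \<cong> H"
  shows "AutoGroup G \<cong> AutoGroup H"
proof -
  interpret G: group G by fact
  interpret H: group H by fact
  obtain h where h: "h \<in> iso G H" using assms(3) by (auto simp: is_iso_def)
  define k where "k = inv_into (carrier G) h"
  have k: "k \<in> iso H G" unfolding k_def using h by (rule G.iso_set_sym)
  have bij: "bij_betw h (carrier G) (carrier H)" using h by (simp add: iso_def)
  have kh: "k (h x) = x" if "x \<in> carrier G" for x
    using that bij by (simp add: k_def bij_betw_inv_into_left)
  have hk: "h (k y) = y" if "y \<in> carrier H" for y
    using that bij by (simp add: k_def bij_betw_inv_into_right)
  have hc: "h x \<in> carrier H" if "x \<in> carrier G" for x
    using that h by (auto simp: iso_def hom_def)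
  have kc: "k y \<in> carrier G" if "y \<in> carrier H" for y
    using that k by (auto simp: iso_def hom_def)
  define T where "T = (\<lambda>f. \<lambda>y\<in>carrier H. h (f (k y)))"
  define S where "S = (\<lambda>f. \<lambda>x\<in>carrier G. k (f (h x)))"
  have T: "T f \<in> carrier (AutoGroup H)" if "f \<in> carrier (AutoGroup G)" for f
  proof -
    have "f \<in> iso G G" using that by (simp add: carrier_AutoGroup_iff iso_def)
    hence "h \<circ> (f \<circ> k) \<in> iso H H" using h k by (intro iso_set_trans)
    from H.restrict_iso_in_AutoGroup[OF this] show ?thesis by (simp add: T_def o_def)
  qed
  have S: "S f \<in> carrier (AutoGroup G)" if "f \<in> carrier (AutoGroup H)" for f
  proof -
    have "f \<in> iso H H" using that by (simp add: carrier_AutoGroup_iff iso_def)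
    hence "k \<circ> (f \<circ> h) \<in> iso G G" using h k by (intro iso_set_trans)
    from G.restrict_iso_in_AutoGroup[OF this] show ?thesis by (simp add: S_def o_def)
  qed
  have fc: "f x \<in> carrier G" if "f \<in> carrier (AutoGroup G)" "x \<in> carrier G" for f x
    using that by (auto simp: carrier_AutoGroup_iff hom_def)
  have fc': "f x \<in> carrier H" if "f \<in> carrier (AutoGroup H)" "x \<in> carrier H" for f x
    using that by (auto simp: carrier_AutoGroup_iff hom_def)
  have "T \<in> hom (AutoGroup G) (AutoGroup H)"
  proof (rule homI)
    fix f g assume fg: "f \<in> carrier (AutoGroup G)" "g \<in> carrier (AutoGroup G)"
    have "T (compose (carrier G) f g) y = compose (carrier H) (T f) (T g) y" for y
      using fg by (cases "y \<in> carrier H") (simp_all add: T_def compose_def kh kc fc hc)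
    thus "T (f \<otimes>\<^bsub>AutoGroup G\<^esub> g) = T f \<otimes>\<^bsub>AutoGroup H\<^esub> T g"
      using fg by (simp add: mult_AutoGroup T fun_eq_iff)
  qed (rule T)
  moreover have "bij_betw T (carrier (AutoGroup G)) (carrier (AutoGroup H))"
  proof (rule bij_betw_byWitness[where f' = S])
    show "\<forall>f\<in>carrier (AutoGroup G). S (T f) = f"
    proof (intro ballI ext)
      fix f x assume f: "f \<in> carrier (AutoGroup G)"
      show "S (T f) x = f x"
        using f fc[OF f] by (cases "x \<in> carrier G")
          (simp_all add: S_def T_def kh hc carrier_AutoGroup_iff extensional_def)
    qed
    show "\<forall>f\<in>carrier (AutoGroup H). T (S f) = f"
    proof (intro ballI ext)
      fix f y assume f: "f \<in> carrier (AutoGroup H)"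
      show "T (S f) y = f y"
        using f fc'[OF f] by (cases "y \<in> carrier H")
          (simp_all add: S_def T_def hk kc carrier_AutoGroup_iff extensional_def)
    qed
  qed (use T S in auto)
  ultimately show ?thesis by (auto simp: is_iso_def iso_def)
qed

section \<open>Words in a group\<close>

context group
begin

lemma eval_word_winv:
  assumes f: "\<And>x. f x \<in> carrier G"
  shows "eval_word f (winv w) = inv (eval_word f w)"
proof (induction w)
  case Nil
  show ?case by (simp add: eval_word_def winv_def)
next
  case (Cons l w)
  obtain x e where l: "l = (x, e)" by (cases l)
  have "eval_word f (winv (l # w)) = inv (eval_word f w) \<otimes> (if e then inv (f x) else f x)"
    using f by (simp add: l winv_Cons eval_word_append Cons.IH) (simp add: eval_word_def)
  moreover have "eval_word f (l # w) = (if e then f x else inv (f x)) \<otimes> eval_word f w"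
    by (simp add: eval_word_def l)
  ultimately show ?case
    using f[of x] eval_word_closed[of f w, OF f] by (simp add: inv_mult_group)
qed

lemma eval_word_concat_replicate:
  assumes f: "\<And>x. f x \<in> carrier G"
  shows "eval_word f (concat (replicate k w)) = eval_word f w [^] k"
proof (induction k)
  case 0
  show ?case by (simp add: eval_word_def)
next
  case (Suc k)
  have "eval_word f w \<in> carrier G" by (rule eval_word_closed[OF f])
  note c = this
  have "eval_word f (concat (replicate (Suc k) w)) = eval_word f w \<otimes> eval_word f w [^] k"
    using Suc by (simp only: replicate_Suc concat.simps eval_word_append[OF f])
  also have "\<dots> = eval_word f w [^] Suc k" by (rule nat_pow_Suc2[OF c, symmetric])
  finally show ?case .
qed

lemma eval_word_wpow:
  assumes f: "\<And>x. f x \<in> carrier G"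
  shows "eval_word f (wpow w k) = eval_word f w [^] k"
proof (cases "k \<ge> 0")
  case True
  have "eval_word f (wpow w k) = eval_word f w [^] nat k"
    unfolding wpow_def if_P[OF True] by (rule eval_word_concat_replicate[OF f])
  thus ?thesis using True by (simp add: pow_nat)
next
  case False
  hence neg: "k < 0" by simp
  have "eval_word f (wpow w k) = inv (eval_word f w) [^] nat (- k)"
    unfolding wpow_def if_not_P[OF False] eval_word_concat_replicate[OF f] eval_word_winv[OF f] ..
  also have "\<dots> = inv (eval_word f w [^] nat (- k))"
    by (rule nat_pow_inv[OF eval_word_closed[OF f]])
  also have "\<dots> = eval_word f w [^] k"
    unfolding int_pow_def2 if_P[OF neg] ..
  finally show ?thesis .
qed

lemma eval_word_gen: "f x \<in> carrier G \<Longrightarrow> eval_word f (gen x) = f x"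
  by (simp add: eval_word_def gen_def)

lemma eval_word_wcomm_eq_one_iff:
  assumes f: "\<And>x. f x \<in> carrier G"
  shows "eval_word f (wcomm u v) = \<one> \<longleftrightarrow> eval_word f u \<otimes> eval_word f v = eval_word f v \<otimes> eval_word f u"
proof -
  let ?u = "eval_word f u" and ?v = "eval_word f v"
  have c: "?u \<in> carrier G" "?v \<in> carrier G" by (rule eval_word_closed[OF f])+
  have "eval_word f (wcomm u v) = inv (?v \<otimes> ?u) \<otimes> (?u \<otimes> ?v)"
    using c by (simp add: wcomm_def eval_word_append f eval_word_winv inv_mult_group m_assoc)
  thus ?thesis using c by (metis inv_solve_left m_closed r_one one_closed)
qed

text \<open>
  Conjugation by \<open>g\<close> is a homomorphism, so the relation passes from \<open>x\<close> and \<open>y\<close> to their powers.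
\<close>

lemma conjugate_int_pow:
  assumes "g \<in> carrier G" "x \<in> carrier G" "y \<in> carrier G" "g \<otimes> x = y \<otimes> g"
  shows "g \<otimes> x [^] (k::int) = y [^] k \<otimes> g"
proof -
  let ?c = "\<lambda>z. g \<otimes> z \<otimes> inv g"
  have "?c \<in> hom G G"
  proof (rule homI)
    fix u v assume "u \<in> carrier G" "v \<in> carrier G"
    thus "?c (u \<otimes> v) = ?c u \<otimes> ?c v"
      using assms(1) by (simp add: m_assoc inv_solve_left)
  qed (use assms(1) in simp)
  hence "?c (x [^] k) = ?c x [^] k"
    using assms(2) is_group by (intro hom_int_pow)
  moreover have "?c x = y" using assms by (simp add: m_assoc)
  ultimately have "g \<otimes> x [^] k \<otimes> inv g = y [^] k" by simp
  thus ?thesis using assms(1-3) by (metis int_pow_closed inv_solve_right' m_closed)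
qed

lemma int_pow_cong:
  assumes "x \<in> carrier G" "x [^] (m::int) = \<one>" "[k = l] (mod m)"
  shows "x [^] k = x [^] l"
proof -
  obtain d where d: "k = l + m * d" using assms(3) by (metis cong_iff_lin cong_sym)
  have "x [^] (m * d) = (x [^] m) [^] d" using assms(1) by (simp add: int_pow_pow)
  thus ?thesis using assms(1,2) by (simp add: d int_pow_mult)
qed

text \<open>
  This bounds the presented group from above: together with a homomorphism to a group in which the
  exponents can be read off from the value, it yields injectivity of that homomorphism. Each letter
  of the word can be pushed past the powers of \<open>B\<close> and \<open>C\<close>. Inverses \<open>s\<close> and \<open>s'\<close> of the
  exponents modulo \<open>m\<close> are needed because the relations say how \<open>inv A\<close> moves past \<open>B\<close> and
  \<open>C\<close>, while the word may also contain \<open>A\<close>.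
\<close>

lemma normal_form:
  fixes A B C :: 'a and r s r' s' m :: int
  assumes cl: "A \<in> carrier G" "B \<in> carrier G" "C \<in> carrier G"
    and ord: "B [^] m = \<one>" "C [^] m = \<one>" and BC: "B \<otimes> C = C \<otimes> B"
    and AB: "inv A \<otimes> B \<otimes> A = B [^] r" and AC: "inv A \<otimes> C \<otimes> A = C [^] r'"
    and rs: "[r * s = 1] (mod m)" "[r' * s' = 1] (mod m)"
  shows "\<exists>j k i. eval_word (case_abc A B C) w = B [^] (j::int) \<otimes> C [^] (k::int) \<otimes> A [^] (i::int)"
proof -
  have inv_AX: "inv A \<otimes> X = X [^] u \<otimes> inv A"
    if "X \<in> carrier G" "inv A \<otimes> X \<otimes> A = X [^] u" for X and u :: int
    using that cl by (metis inv_closed inv_solve_right m_closed)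
  have AX: "A \<otimes> X = X [^] v \<otimes> A"
    if X: "X \<in> carrier G" "inv A \<otimes> X \<otimes> A = X [^] u" "X [^] m = \<one>" "[u * v = 1] (mod m)"
    for X and u v :: int
  proof -
    have "inv A \<otimes> X [^] v = (X [^] u) [^] v \<otimes> inv A"
      using X cl inv_AX by (intro conjugate_int_pow) auto
    also have "(X [^] u) [^] v = X [^] (1::int)"
      using X by (simp only: int_pow_pow) (rule int_pow_cong)
    finally have "inv A \<otimes> X [^] v = X \<otimes> inv A" using X(1) by (simp add: int_pow_1)
    hence "A \<otimes> (inv A \<otimes> X [^] v) \<otimes> A = A \<otimes> (X \<otimes> inv A) \<otimes> A" by simp
    thus ?thesis using X(1) cl by (simp add: m_assoc[symmetric]) (simp add: m_assoc)
  qed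
  have push: "g \<otimes> (B [^] j \<otimes> C [^] k \<otimes> h) = B [^] (u * j) \<otimes> C [^] (v * k) \<otimes> (g \<otimes> h)"
    if g: "g \<in> carrier G" "h \<in> carrier G" "g \<otimes> B = B [^] u \<otimes> g" "g \<otimes> C = C [^] v \<otimes> g"
    for g h and j k u v :: int
  proof -
    have B: "g \<otimes> B [^] j = B [^] (u * j) \<otimes> g" and C: "g \<otimes> C [^] k = C [^] (v * k) \<otimes> g"
      using conjugate_int_pow[of g B "B [^] u" j] conjugate_int_pow[of g C "C [^] v" k] cl g
      by (simp_all add: int_pow_pow)
    have "g \<otimes> (B [^] j \<otimes> C [^] k \<otimes> h) = (g \<otimes> B [^] j) \<otimes> C [^] k \<otimes> h"
      using cl g(1,2) by (simp add: m_assoc)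
    also have "\<dots> = B [^] (u * j) \<otimes> (g \<otimes> C [^] k) \<otimes> h"
      unfolding B using cl g(1,2) by (simp add: m_assoc)
    also have "\<dots> = B [^] (u * j) \<otimes> C [^] (v * k) \<otimes> (g \<otimes> h)"
      unfolding C using cl g(1,2) by (simp add: m_assoc)
    finally show ?thesis .
  qed
  have comm_inv: "inv C \<otimes> B = B \<otimes> inv C"
    using BC cl by (metis inv_closed inv_solve_left inv_solve_right m_assoc m_closed)
  show ?thesis
  proof (induction w)
    case Nil
    have "eval_word (case_abc A B C) [] = B [^] (0::int) \<otimes> C [^] (0::int) \<otimes> A [^] (0::int)"
      by (simp add: eval_word_def)
    thus ?case by blast
  next
    case (Cons l w)
    obtain x e where l: "l = (x, e)" by (cases l)
    define \<epsilon> :: int where "\<epsilon> = (if e then 1 else - 1)"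
    have letter: "(if e then y else inv y) = y [^] \<epsilon>" if "y \<in> carrier G" for y
      using that by (auto simp: \<epsilon>_def int_pow_neg int_pow_1)
    obtain j k i :: int where IH: "eval_word (case_abc A B C) w = B [^] j \<otimes> C [^] k \<otimes> A [^] i"
      using Cons.IH by blast
    have step: "eval_word (case_abc A B C) (l # w) =
        (if e then case_abc A B C x else inv (case_abc A B C x)) \<otimes> (B [^] j \<otimes> C [^] k \<otimes> A [^] i)"
      by (simp add: l eval_word_def flip: IH)
    show ?case
    proof (cases x)
      case a
      define g where "g = (if e then A else inv A)"
      have g: "g \<in> carrier G" using cl by (simp add: g_def)
      obtain u v :: int where "g \<otimes> B = B [^] u \<otimes> g" "g \<otimes> C = C [^] v \<otimes> g"
      proof (cases e)
        case True
        thus ?thesis using that[of s s'] AX[OF cl(2) AB ord(1) rs(1)] AX[OF cl(3) AC ord(2) rs(2)]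
          by (simp add: g_def)
      next
        case False
        thus ?thesis using that[of r r'] inv_AX[OF cl(2) AB] inv_AX[OF cl(3) AC]
          by (simp add: g_def)
      qed
      moreover have "g \<otimes> A [^] i = A [^] (\<epsilon> + i)"
        unfolding g_def letter[OF cl(1)] using cl by (simp add: int_pow_mult)
      ultimately have "eval_word (case_abc A B C) (l # w) =
          B [^] (u * j) \<otimes> C [^] (v * k) \<otimes> A [^] (\<epsilon> + i)"
        using step push[of g "A [^] i" u v j k] g cl by (cases e) (simp_all add: a g_def)
      thus ?thesis by blast
    next
      case b
      have "eval_word (case_abc A B C) (l # w) = B [^] (\<epsilon> + j) \<otimes> C [^] k \<otimes> A [^] i"
        unfolding step using b cl by (simp only: abc.case letter) (simp add: int_pow_mult m_assoc)
      thus ?thesis by blast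
    next
      case c
      define g where "g = (if e then C else inv C)"
      have g: "g \<in> carrier G" using cl by (simp add: g_def)
      have "g \<otimes> B = B [^] (1::int) \<otimes> g" "g \<otimes> C = C [^] (1::int) \<otimes> g"
        using BC comm_inv cl unfolding g_def by (auto simp: int_pow_1)
      hence "eval_word (case_abc A B C) (l # w) = B [^] j \<otimes> C [^] k \<otimes> (g \<otimes> A [^] i)"
        using step push[of g "A [^] i" 1 1 j k] g cl by (cases e) (simp_all add: c g_def)
      also have "\<dots> = B [^] j \<otimes> (C [^] k \<otimes> C [^] \<epsilon>) \<otimes> A [^] i"
        unfolding g_def letter[OF cl(3)] using cl by (simp add: m_assoc)
      also have "\<dots> = B [^] j \<otimes> C [^] (k + \<epsilon>) \<otimes> A [^] i"
        using cl by (simp add: int_pow_mult)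
      finally show ?thesis by blast
    qed
  qed
qed

end

text \<open>
  With this, equalities that hold for the evaluation of words in any group become facts about
  classes of words.
\<close>

lemma eval_word_pres_class:
  "group.eval_word (presented_group R) (\<lambda>x. pres_class R (gen x)) w = pres_class R w"
proof -
  interpret group "presented_group R" by (rule group_presented_group)
  let ?f = "\<lambda>x. pres_class R (gen x)"
  have f: "?f x \<in> carrier (presented_group R)" for x by (simp add: presented_group_carrier)
  show ?thesis
  proof (induction w)
    case Nil
    show ?case by (simp add: eval_word_def presented_group_one)
  next
    case (Cons l w)
    obtain x e where l: "l = (x, e)" by (cases l)
    have "pres_class R [(x, False)] \<otimes>\<^bsub>presented_group R\<^esub> ?f x = \<one>\<^bsub>presented_group R\<^esub>"
      using pres_eq.cancel[of R x False]
      by (simp add: presented_group_mult presented_group_one pres_class_eq_iff gen_def)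
    hence "inv\<^bsub>presented_group R\<^esub> ?f x = pres_class R [(x, False)]"
      by (intro inv_equality) (auto simp: presented_group_carrier)
    hence "(if e then ?f x else inv\<^bsub>presented_group R\<^esub> ?f x) = pres_class R [l]"
      by (cases e) (auto simp: l gen_def)
    thus ?case using Cons.IH by (simp add: eval_word_def l presented_group_mult)
  qed
qed

section \<open>The group as a concrete semidirect product\<close>

text \<open>
  Here \<open>\<omega>\<close> is a discrete exponential modulo \<open>p\<close>, with values reduced modulo \<open>p\<close> so that its laws are
  equations instead of congruences. The eigenvalues of the generator of the cyclic factor on
  \<open>V\<close> are \<open>\<omega> \<kappa>\<close> and \<open>\<omega> (n \<kappa>)\<close>; the condition on \<open>\<kappa>\<close> says that \<open>\<omega> \<kappa>\<close> has order \<open>q\<close>. That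
  \<open>n \<noteq> 0\<close> modulo \<open>q\<close> makes both eigenvalues nontrivial, and \<open>n\<^sup>2 \<noteq> 1\<close> prevents an automorphism
  from exchanging or mixing the two eigenlines.
\<close>

locale diagonal_extension =
  fixes p q n :: nat and \<omega> :: "int \<Rightarrow> int" and \<kappa> :: int
  assumes prime_p: "prime p" and prime_q: "prime q" and p_neq_q: "p \<noteq> q"
    and omega_0: "\<omega> 0 = 1"
    and omega_add: "\<omega> (x + y) = \<omega> x * \<omega> y mod int p"
    and omega_inj: "\<omega> x = \<omega> y \<longleftrightarrow> int (p - 1) dvd x - y"
    and omega_onto: "\<not> int p dvd z \<Longrightarrow> \<exists>x. \<omega> x = z mod int p"
    and kappa_dvd_iff: "int (p - 1) dvd \<kappa> * k \<longleftrightarrow> int q dvd k"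
    and n_not_dvd: "\<not> int q dvd int n" "\<not> int q dvd int n * int n - 1"
begin

lemma p_gt_1: "p > 1"
  using prime_p by (rule prime_gt_1_nat)

lemma cong_mod_self: "[a mod m = a] (mod m)" for a m :: int
  by (simp add: cong_def)

lemma omega_mod: "\<omega> x mod int p = \<omega> x"
  using omega_add[of x 0] by (simp add: omega_0)

lemma omega_minus: "\<omega> (- x) * \<omega> x mod int p = 1" "\<omega> x * \<omega> (- x) mod int p = 1"
  using omega_add[of "- x" x] omega_add[of x "- x"] by (simp_all add: omega_0)

lemma omega_cancel:
  assumes "\<omega> x * u mod int p = \<omega> y * u mod int p" "\<not> int p dvd u"
  shows "int (p - 1) dvd x - y"
proof -
  have "int p dvd (\<omega> x - \<omega> y) * u"
    using assms(1) by (simp add: mod_eq_dvd_iff left_diff_distrib)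
  hence "int p dvd \<omega> x - \<omega> y"
    using assms(2) prime_p by (simp add: prime_dvd_mult_iff)
  hence "\<omega> x = \<omega> y"
    using omega_mod by (metis mod_eq_dvd_iff)
  thus ?thesis by (simp add: omega_inj)
qed

lemma not_dvd_omega: "\<not> int p dvd \<omega> x"
proof
  assume "int p dvd \<omega> x"
  hence "\<omega> (- x) * \<omega> x mod int p = 0" by simp
  thus False using omega_minus(1)[of x] by simp
qed

abbreviation V :: "(int \<times> int) monoid" where
  "V \<equiv> integer_mod_group p \<times>\<times> integer_mod_group p"

lemma group_V: "group V"
  by (intro DirProd_group) simp_all

lemma carrier_Zp [simp]: "carrier (integer_mod_group p) = {0..<int p}"
  using p_gt_1 by (simp add: carrier_integer_mod_group)

lemma p_pos [simp]: "0 < int p" "0 < p" "Suc 0 < p" "1 < int p"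
  using p_gt_1 by simp_all

definition diag :: "int \<times> int \<Rightarrow> int \<times> int \<Rightarrow> int \<times> int" where
  "diag m = (\<lambda>u\<in>carrier V. (\<omega> (fst m) * fst u mod int p, \<omega> (snd m) * snd u mod int p))"

lemma diag_apply:
  "\<lbrakk>0 \<le> x; x < int p; 0 \<le> y; y < int p\<rbrakk> \<Longrightarrow>
    diag (i, j) (x, y) = (\<omega> i * x mod int p, \<omega> j * y mod int p)"
  by (simp add: diag_def)

lemma omega_minus_cancel:
  "\<lbrakk>0 \<le> x; x < int p\<rbrakk> \<Longrightarrow> \<omega> (- i) * (\<omega> i * x) mod int p = x"
  "\<lbrakk>0 \<le> x; x < int p\<rbrakk> \<Longrightarrow> \<omega> i * (\<omega> (- i) * x) mod int p = x"
  using omega_minus[of i] mod_mult_left_eq[of "\<omega> (- i) * \<omega> i" "int p" x]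
    mod_mult_left_eq[of "\<omega> i * \<omega> (- i)" "int p" x]
  by (simp_all add: mult.assoc)

lemma diag_in_AutoGroup: "diag m \<in> carrier (AutoGroup V)"
proof -
  interpret V: group V by (rule group_V)
  let ?d = "\<lambda>m u. (\<omega> (fst m) * fst u mod int p, \<omega> (snd m) * snd u mod int p)"
  have "?d m \<in> iso V V"
  proof (rule isoI)
    show "?d m \<in> hom V V"
      using p_gt_1 by (intro homI) (auto simp: mod_simps algebra_simps)
    show "bij_betw (?d m) (carrier V) (carrier V)"
      by (rule bij_betw_byWitness[where f' = "?d (- fst m, - snd m)"])
        (use p_gt_1 in \<open>auto simp: mod_simps omega_minus_cancel\<close>)
  qed
  thus ?thesis unfolding diag_def by (rule V.restrict_iso_in_AutoGroup)
qed

lemma diag_cong: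
  assumes "int (p - 1) dvd fst m - fst m'" "int (p - 1) dvd snd m - snd m'"
  shows "diag m = diag m'"
proof -
  have "\<omega> (fst m) = \<omega> (fst m')" "\<omega> (snd m) = \<omega> (snd m')"
    using assms by (simp_all only: omega_inj)
  thus ?thesis by (simp add: diag_def)
qed

lemma diag_add:
  "diag (fst m + fst m', snd m + snd m') = diag m \<otimes>\<^bsub>AutoGroup V\<^esub> diag m'"
proof -
  have "diag (fst m + fst m', snd m + snd m') = compose (carrier V) (diag m) (diag m')"
    using p_gt_1 by (auto simp: fun_eq_iff compose_def diag_def omega_add mod_simps mult.assoc)
  thus ?thesis by (simp add: mult_AutoGroup diag_in_AutoGroup)
qed

lemma diag_hom: "diag \<in> hom (integer_mod_group (p - 1) \<times>\<times> integer_mod_group (p - 1)) (AutoGroup V)"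
proof (rule homI)
  fix m m' assume "m \<in> carrier (integer_mod_group (p - 1) \<times>\<times> integer_mod_group (p - 1))"
    "m' \<in> carrier (integer_mod_group (p - 1) \<times>\<times> integer_mod_group (p - 1))"
  have "diag (m \<otimes>\<^bsub>integer_mod_group (p - 1) \<times>\<times> integer_mod_group (p - 1)\<^esub> m')
      = diag (fst m + fst m', snd m + snd m')"
    by (rule diag_cong) (simp_all add: mult_DirProd' mod_eq_dvd_iff[symmetric])
  thus "diag (m \<otimes>\<^bsub>integer_mod_group (p - 1) \<times>\<times> integer_mod_group (p - 1)\<^esub> m')
      = diag m \<otimes>\<^bsub>AutoGroup V\<^esub> diag m'"
    by (simp add: diag_add)
qed (rule diag_in_AutoGroup)

text \<open>
  The two characters by which the cyclic factor acts on the two coordinates of \<open>V\<close>. They have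
  period \<open>q\<close>, so the action factors through \<open>\<int>\<^sub>q\<close> although the cyclic factor has order \<open>q\<^sup>2\<close>.
\<close>

definition \<chi> :: "int \<Rightarrow> int" where "\<chi> i = \<omega> (\<kappa> * i)"

definition \<chi>' :: "int \<Rightarrow> int" where "\<chi>' i = \<omega> (\<kappa> * (int n * i))"

lemma kappa_period: "int q dvd i - j \<Longrightarrow> int (p - 1) dvd \<kappa> * i - \<kappa> * j"
  "int q dvd i - j \<Longrightarrow> int (p - 1) dvd \<kappa> * (int n * i) - \<kappa> * (int n * j)"
  unfolding right_diff_distrib[symmetric] kappa_dvd_iff by simp_all

lemma chi_cong: "int q dvd i - j \<Longrightarrow> \<chi> i = \<chi> j" "int q dvd i - j \<Longrightarrow> \<chi>' i = \<chi>' j"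
  unfolding \<chi>_def \<chi>'_def omega_inj by (rule kappa_period; assumption)+

lemma chi_add: "\<chi> (i + j) = \<chi> i * \<chi> j mod int p" "\<chi>' (i + j) = \<chi>' i * \<chi>' j mod int p"
  unfolding \<chi>_def \<chi>'_def omega_add[symmetric] by (simp_all add: ring_distribs)

lemma chi_0: "\<chi> 0 = 1" "\<chi>' 0 = 1"
  by (simp_all add: \<chi>_def \<chi>'_def omega_0)

lemma chi_mod: "\<chi> (i mod (int q)\<^sup>2) = \<chi> i" "\<chi>' (i mod (int q)\<^sup>2) = \<chi>' i"
proof -
  have "(int q)\<^sup>2 dvd i mod (int q)\<^sup>2 - i" by (rule mod_eq_dvd_iff[THEN iffD1]) simp
  hence "int q dvd i mod (int q)\<^sup>2 - i" unfolding power2_eq_square by (rule dvd_mult_left)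
  thus "\<chi> (i mod (int q)\<^sup>2) = \<chi> i" "\<chi>' (i mod (int q)\<^sup>2) = \<chi>' i"
    by (rule chi_cong)+
qed

lemma chi_mult: "\<chi> (i * (1 + int q * t)) = \<chi> i" "\<chi>' (i * (1 + int q * t)) = \<chi>' i"
  by (rule chi_cong; simp add: algebra_simps)+

definition \<theta> :: "int \<Rightarrow> int \<times> int \<Rightarrow> int \<times> int" where
  "\<theta> i = diag (\<kappa> * i, \<kappa> * (int n * i))"

lemma theta_hom: "\<theta> \<in> hom (integer_mod_group (q\<^sup>2)) (AutoGroup V)"
proof (rule homI)
  fix i j assume "i \<in> carrier (integer_mod_group (q\<^sup>2))" "j \<in> carrier (integer_mod_group (q\<^sup>2))"
  have "(int q)\<^sup>2 dvd (i + j) mod (int q)\<^sup>2 - (i + j)" by (rule mod_eq_dvd_iff[THEN iffD1]) simp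
  hence "int q dvd (i + j) mod (int q)\<^sup>2 - (i + j)" unfolding power2_eq_square by (rule dvd_mult_left)
  hence "\<theta> (i \<otimes>\<^bsub>integer_mod_group (q\<^sup>2)\<^esub> j) = \<theta> (i + j)"
    unfolding \<theta>_def
    by (intro diag_cong) (simp_all only: fst_conv snd_conv mult_integer_mod_group of_nat_power kappa_period)
  also have "\<dots> = \<theta> i \<otimes>\<^bsub>AutoGroup V\<^esub> \<theta> j"
    unfolding \<theta>_def diag_add[symmetric] by (simp add: ring_distribs)
  finally show "\<theta> (i \<otimes>\<^bsub>integer_mod_group (q\<^sup>2)\<^esub> j) = \<theta> i \<otimes>\<^bsub>AutoGroup V\<^esub> \<theta> j" .
qed (simp add: \<theta>_def diag_in_AutoGroup)

text \<open>
  The pair \<open>((x, y), i)\<close> stands for \<open>b\<^sup>x c\<^sup>y a\<^sup>i\<close>, see \<open>H_factor\<close>.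
\<close>

definition H :: "((int \<times> int) \<times> int) monoid" where
  "H = semidirect V \<theta> (integer_mod_group (q\<^sup>2))"

lemma group_H: "group H"
  unfolding H_def by (intro group_semidirect group_V theta_hom) simp

lemma q_pos: "0 < int q" "q \<noteq> 0"
  using prime_q prime_gt_0_nat by auto

lemma carrier_H: "carrier H = ({0..<int p} \<times> {0..<int p}) \<times> {0..<(int q)\<^sup>2}"
  using q_pos by (simp add: H_def semidirect_def carrier_integer_mod_group)

lemma one_H: "\<one>\<^bsub>H\<^esub> = ((0, 0), 0)"
  by (simp add: H_def semidirect_def)

lemma mult_H:
  "\<lbrakk>0 \<le> x'; x' < int p; 0 \<le> y'; y' < int p\<rbrakk> \<Longrightarrow>
    ((x, y), i) \<otimes>\<^bsub>H\<^esub> ((x', y'), j) =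
      (((x + \<chi> i * x') mod int p, (y + \<chi>' i * y') mod int p), (i + j) mod (int q)\<^sup>2)"
  by (simp add: H_def semidirect_def \<theta>_def diag_apply \<chi>_def \<chi>'_def mod_simps)

lemma in_carrier_H: "((x mod int p, y mod int p), i mod (int q)\<^sup>2) \<in> carrier H"
  using p_gt_1 q_pos by (simp add: carrier_H)

text \<open>
  The right-hand side is additive in \<open>k\<close>, and a homomorphism from the integers is determined by its
  value at \<open>1\<close>.
\<close>

lemma V_int_pow:
  assumes "0 \<le> x" "x < int p" "0 \<le> y" "y < int p"
  shows "((x, y), 0) [^]\<^bsub>H\<^esub> (k::int) = ((k * x mod int p, k * y mod int p), 0)"
proof -
  let ?f = "\<lambda>k. ((k * x mod int p, k * y mod int p), 0)"
  have "?f \<in> hom integer_group H"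
    by (intro homI) (simp_all add: carrier_H mult_H chi_0 mod_simps ring_distribs q_pos)
  hence "?f 1 [^]\<^bsub>H\<^esub> k = ?f k"
    using hom_int_pow[of ?f integer_group H 1 k] group_H by simp
  thus ?thesis using assms by simp
qed

lemma A_int_pow: "((0, 0), 1) [^]\<^bsub>H\<^esub> (k::int) = ((0, 0), k mod (int q)\<^sup>2)"
proof -
  let ?f = "\<lambda>k. ((0, 0), k mod (int q)\<^sup>2)"
  have "1 < (int q)\<^sup>2" using prime_q prime_gt_1_nat[of q] by (simp add: one_less_power)
  moreover have "?f \<in> hom integer_group H"
    by (intro homI) (simp_all add: carrier_H mult_H mod_simps q_pos)
  hence "?f 1 [^]\<^bsub>H\<^esub> k = ?f k"
    using hom_int_pow[of ?f integer_group H 1 k] group_H by simp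
  ultimately show ?thesis by simp
qed

lemma H_factor:
  assumes "((x, y), i) \<in> carrier H"
  shows "((x, y), i) =
    ((1, 0), 0) [^]\<^bsub>H\<^esub> x \<otimes>\<^bsub>H\<^esub> ((0, 1), 0) [^]\<^bsub>H\<^esub> y \<otimes>\<^bsub>H\<^esub> ((0, 0), 1) [^]\<^bsub>H\<^esub> i"
  using assms by (simp add: V_int_pow A_int_pow mult_H chi_0 carrier_H)

lemma gens_in_carrier_H:
  "((0, 0), 1) \<in> carrier H" "((1, 0), 0) \<in> carrier H" "((0, 1), 0) \<in> carrier H"
  using prime_q prime_gt_1_nat[of q] by (simp_all add: carrier_H q_pos one_less_power)

section \<open>Automorphisms of the concrete group\<close>

text \<open>
  First the twist \<open>i \<mapsto> i (1 + q t)\<close> of the cyclic factor, then the diagonal matrix with entries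
  \<open>\<omega> k\<close> and \<open>\<omega> l\<close> on \<open>V\<close>, then conjugation by \<open>(v, w)\<close>; conjugating \<open>(u, i)\<close> by an element \<open>s\<close> of
  \<open>V\<close> gives \<open>(s + u - D\<^sup>i s, i)\<close>, where the twist does not change \<open>D\<^sup>i\<close> because \<open>D\<^sup>q = 1\<close>.
\<close>

definition aut :: "(int \<times> int) \<times> ((int \<times> int) \<times> int) \<Rightarrow> (int \<times> int) \<times> int \<Rightarrow> (int \<times> int) \<times> int" where
  "aut = (\<lambda>((v, w), ((k, l), t)). \<lambda>g\<in>carrier H. case g of ((x, y), i) \<Rightarrow>
     (((v + \<omega> k * x - \<chi> i * v) mod int p, (w + \<omega> l * y - \<chi>' i * w) mod int p),
      i * (1 + int q * t) mod (int q)\<^sup>2))"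

lemma aut_apply:
  assumes "((x, y), i) \<in> carrier H"
  shows "aut ((v, w), ((k, l), t)) ((x, y), i) =
    (((v + \<omega> k * x - \<chi> i * v) mod int p, (w + \<omega> l * y - \<chi>' i * w) mod int p),
      i * (1 + int q * t) mod (int q)\<^sup>2)"
  using assms by (simp add: aut_def)

lemma aut_closed: "g \<in> carrier H \<Longrightarrow> aut z g \<in> carrier H"
  by (cases z; cases g) (auto simp: aut_apply carrier_H q_pos split: prod.splits)

lemma aut_hom: "aut z \<in> hom H H"
proof (rule homI)
  fix g h assume gh: "g \<in> carrier H" "h \<in> carrier H"
  obtain v w k l t where z: "z = ((v, w), ((k, l), t))" by (metis prod.collapse)
  obtain x y i where g: "g = ((x, y), i)" by (metis prod.collapse)
  obtain x' y' j where h: "h = ((x', y'), j)" by (metis prod.collapse)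
  have b: "0 \<le> x'" "x' < int p" "0 \<le> y'" "y' < int p" using gh(2) by (auto simp: h carrier_H)
  \<comment> \<open>The coordinate identity behind \<open>aut_hom\<close>: \<open>e\<close> is an entry of the
    diagonal matrix, \<open>c\<close> and \<open>d\<close> are the eigenvalues of \<open>D\<^sup>i\<close> and \<open>D\<^sup>j\<close>.\<close>
  have eq: "(v + e * ((x + c * x') mod int p) - c * d mod int p * v) mod int p =
      ((v + e * x - c * v) mod int p + c * ((v + e * x' - d * v) mod int p)) mod int p"
    for v e x x' c d :: int
  proof -
    have "[v + e * ((x + c * x') mod int p) - c * d mod int p * v = v + e * (x + c * x') - c * d * v] (mod int p)"
      by (intro cong_add cong_diff cong_mult cong_refl cong_mod_self)
    also have "v + e * (x + c * x') - c * d * v = (v + e * x - c * v) + c * (v + e * x' - d * v)"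
      by (simp add: algebra_simps)
    also have "[\<dots> = (v + e * x - c * v) mod int p + c * ((v + e * x' - d * v) mod int p)] (mod int p)"
      by (rule cong_sym) (intro cong_add cong_mult cong_refl cong_mod_self)
    finally show ?thesis by (simp add: cong_def)
  qed
  have lin: "(i + j) mod (int q)\<^sup>2 * (1 + int q * t) mod (int q)\<^sup>2 =
      (i * (1 + int q * t) mod (int q)\<^sup>2 + j * (1 + int q * t) mod (int q)\<^sup>2) mod (int q)\<^sup>2"
    by (simp only: mod_mult_left_eq mod_add_eq distrib_right[of i j])
  have "aut z (g \<otimes>\<^bsub>H\<^esub> h) =
      (((v + \<omega> k * ((x + \<chi> i * x') mod int p) - \<chi> i * \<chi> j mod int p * v) mod int p,
        (w + \<omega> l * ((y + \<chi>' i * y') mod int p) - \<chi>' i * \<chi>' j mod int p * w) mod int p),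
       (i + j) mod (int q)\<^sup>2 * (1 + int q * t) mod (int q)\<^sup>2)"
    using b unfolding g h z mult_H[OF b] aut_apply[OF in_carrier_H]
    by (simp only: chi_mod chi_add)
  also have "\<dots> = aut z g \<otimes>\<^bsub>H\<^esub> aut z h"
    unfolding z g h aut_apply[OF gh(1)[unfolded g]] aut_apply[OF gh(2)[unfolded h]]
    using lin by (subst mult_H) (simp_all add: eq chi_mod chi_mult)
  finally show "aut z (g \<otimes>\<^bsub>H\<^esub> h) = aut z g \<otimes>\<^bsub>H\<^esub> aut z h" .
qed (rule aut_closed)

text \<open>
  The second component vanishes only for \<open>i = 0\<close>, as \<open>1 + q t\<close> is a unit modulo \<open>q\<^sup>2\<close>. Then the
  contributions of the conjugation cancel, and what remains is multiplication by units.
\<close>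

lemma aut_kernel:
  assumes "g \<in> carrier H" "aut z g = \<one>\<^bsub>H\<^esub>"
  shows "g = \<one>\<^bsub>H\<^esub>"
proof -
  obtain v w k l t where z: "z = ((v, w), ((k, l), t))" by (metis prod.collapse)
  obtain x y i where g: "g = ((x, y), i)" by (metis prod.collapse)
  note eqs = assms(2)[unfolded z g aut_apply[OF assms(1)[unfolded g]] one_H]
  have b: "0 \<le> x" "x < int p" "0 \<le> y" "y < int p" "0 \<le> i" "i < (int q)\<^sup>2"
    using assms(1) by (auto simp: g carrier_H)
  have "coprime (int q) (1 + int q * t)"
    by (metis coprime_1_right gcd.commute gcd_add_mult coprime_iff_gcd_eq_1 mult.commute add.commute)
  hence "coprime ((int q)\<^sup>2) (1 + int q * t)" by simp
  moreover have "(int q)\<^sup>2 dvd i * (1 + int q * t)" using eqs by (simp add: mod_eq_0_iff_dvd)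
  ultimately have "(int q)\<^sup>2 dvd i" by (simp add: coprime_dvd_mult_left_iff)
  hence i: "i = 0" using b by (metis dvd_imp_mod_0 mod_pos_pos_trivial)
  have "int p dvd \<omega> k * x" "int p dvd \<omega> l * y" using eqs by (simp_all add: i chi_0 mod_eq_0_iff_dvd)
  hence "int p dvd x" "int p dvd y"
    using prime_p not_dvd_omega by (simp_all add: prime_dvd_mult_iff)
  hence "x = 0" "y = 0" using b by (metis dvd_imp_mod_0 mod_pos_pos_trivial)+
  thus ?thesis by (simp add: g i one_H)
qed

lemma aut_in_AutoGroup: "aut z \<in> carrier (AutoGroup H)"
proof -
  interpret group_hom H H "aut z"
    using aut_hom group_H by (simp add: group_hom_def group_hom_axioms_def)
  have inj: "inj_on (aut z) (carrier H)"
    using aut_kernel[of _ z] by (simp add: inj_on_one_iff)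
  have "finite (carrier H)" by (simp add: carrier_H)
  hence "bij_betw (aut z) (carrier H) (carrier H)"
    using inj aut_closed by (simp add: bij_betw_def endo_inj_surj image_subset_iff)
  moreover have "aut z \<in> extensional (carrier H)"
    by (cases z) (auto simp: aut_def split: prod.splits)
  ultimately show ?thesis using aut_hom by (simp add: carrier_AutoGroup_iff)
qed

lemma aut_cong:
  assumes "int p dvd v - v'" "int p dvd w - w'" "int (p - 1) dvd k - k'" "int (p - 1) dvd l - l'"
    "int q dvd t - t'"
  shows "aut ((v, w), ((k, l), t)) = aut ((v', w'), ((k', l'), t'))"
proof
  fix g
  show "aut ((v, w), ((k, l), t)) g = aut ((v', w'), ((k', l'), t')) g"
  proof (cases "g \<in> carrier H")
    case True
    obtain x y i where g: "g = ((x, y), i)" by (metis prod.collapse)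
    have om: "\<omega> k = \<omega> k'" "\<omega> l = \<omega> l'" using assms(3,4) by (simp_all only: omega_inj)
    have lin: "(a + e - c * a) mod int p = (a' + e - c * a') mod int p"
      if "int p dvd a - a'" for a a' e c :: int
    proof -
      have "(a + e - c * a) - (a' + e - c * a') = (a - a') * (1 - c)" by (simp add: algebra_simps)
      thus ?thesis using that by (simp add: mod_eq_dvd_iff)
    qed
    have "i * (1 + int q * t) - i * (1 + int q * t') = int q * ((t - t') * i)"
      by (simp add: algebra_simps)
    hence "(int q)\<^sup>2 dvd i * (1 + int q * t) - i * (1 + int q * t')"
      using assms(5) by (simp add: power2_eq_square)
    thus ?thesis
      using lin[OF assms(1)] lin[OF assms(2)] True by (simp add: g aut_apply om mod_eq_dvd_iff)
  qed (simp add: aut_def)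
qed

text \<open>
  The law of the semidirect product: a diagonal matrix moves past a conjugation by acting on the
  conjugating element. The exponents of the twists add up, since
  \<open>(1 + q t) (1 + q t') \<equiv> 1 + q (t + t')\<close> modulo \<open>q\<^sup>2\<close>.
\<close>

lemma aut_compose:
  "aut ((v + \<omega> k * v', w + \<omega> l * w'), ((k + k', l + l'), t + t')) =
    compose (carrier H) (aut ((v, w), ((k, l), t))) (aut ((v', w'), ((k', l'), t')))"
proof
  fix g
  show "aut ((v + \<omega> k * v', w + \<omega> l * w'), ((k + k', l + l'), t + t')) g =
    compose (carrier H) (aut ((v, w), ((k, l), t))) (aut ((v', w'), ((k', l'), t'))) g"
  proof (cases "g \<in> carrier H")
    case True
    obtain x y i where g: "g = ((x, y), i)" by (metis prod.collapse)
    have eq: "(v + e * v' + e * e' mod int p * x - c * (v + e * v')) mod int p =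
        (v + e * ((v' + e' * x - c * v') mod int p) - c * v) mod int p" for v e v' e' x c :: int
    proof -
      have "[v + e * v' + e * e' mod int p * x - c * (v + e * v') =
          v + e * v' + e * e' * x - c * (v + e * v')] (mod int p)"
        by (intro cong_add cong_diff cong_mult cong_refl cong_mod_self)
      also have "v + e * v' + e * e' * x - c * (v + e * v') = v + e * (v' + e' * x - c * v') - c * v"
        by (simp add: algebra_simps)
      also have "[\<dots> = v + e * ((v' + e' * x - c * v') mod int p) - c * v] (mod int p)"
        by (rule cong_sym) (intro cong_add cong_diff cong_mult cong_refl cong_mod_self)
      finally show ?thesis by (simp add: cong_def)
    qed
    have "i * (1 + int q * (t + t')) - i * (1 + int q * t') * (1 + int q * t) =
        (int q)\<^sup>2 * (- i * t * t')"
      by (simp add: power2_eq_square algebra_simps)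
    hence "i * (1 + int q * (t + t')) mod (int q)\<^sup>2 =
        i * (1 + int q * t') * (1 + int q * t) mod (int q)\<^sup>2"
      unfolding mod_eq_dvd_iff by (metis dvd_triv_left)
    also have "\<dots> = i * (1 + int q * t') mod (int q)\<^sup>2 * (1 + int q * t) mod (int q)\<^sup>2"
      by (simp add: mod_simps)
    finally show ?thesis
      using True aut_apply[OF True[unfolded g]] aut_apply[OF in_carrier_H]
      by (simp only: g compose_eq omega_add eq chi_mod chi_mult)
  qed (simp add: aut_def compose_def)
qed

abbreviation M :: "(int \<times> int) monoid" where
  "M \<equiv> integer_mod_group (p - 1) \<times>\<times> integer_mod_group (p - 1)"

definition \<psi> :: "int \<Rightarrow> int \<times> int \<Rightarrow> int \<times> int" where
  "\<psi> = (\<lambda>_. \<lambda>m\<in>carrier M. m)"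

text \<open>
  The complement: diagonal matrices together with twists.
\<close>

definition K :: "((int \<times> int) \<times> int) monoid" where
  "K = semidirect M \<psi> (integer_mod_group q)"

definition \<phi> :: "(int \<times> int) \<times> int \<Rightarrow> int \<times> int \<Rightarrow> int \<times> int" where
  "\<phi> = (\<lambda>(m, t). diag m)"

lemma psi_hom: "\<psi> \<in> hom (integer_mod_group q) (AutoGroup M)"
proof -
  interpret M: group M by (intro DirProd_group) simp_all
  have "(\<lambda>m\<in>carrier M. m) = \<one>\<^bsub>AutoGroup M\<^esub>" by (simp add: AutoGroup_def BijGroup_def)
  thus ?thesis
    unfolding \<psi>_def using M.AutoGroup by (intro homI) (auto simp: group.is_monoid)
qed

lemma phi_hom: "\<phi> \<in> hom K (AutoGroup V)"
proof (rule homI)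
  fix a b assume "a \<in> carrier K" "b \<in> carrier K"
  then obtain m t m' t' where ab: "a = (m, t)" "b = (m', t')" "m \<in> carrier M" "m' \<in> carrier M"
    by (auto simp: K_def semidirect_def)
  have "\<phi> (a \<otimes>\<^bsub>K\<^esub> b) = diag (m \<otimes>\<^bsub>M\<^esub> m')"
    using ab(3,4) by (simp add: ab(1,2) K_def semidirect_def \<phi>_def \<psi>_def)
  thus "\<phi> (a \<otimes>\<^bsub>K\<^esub> b) = \<phi> a \<otimes>\<^bsub>AutoGroup V\<^esub> \<phi> b"
    using hom_mult[OF diag_hom ab(3,4)] by (simp add: ab(1,2) \<phi>_def)
qed (auto simp: \<phi>_def diag_in_AutoGroup)

lemma aut_in_hom: "aut \<in> hom (semidirect V \<phi> K) (AutoGroup H)"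
proof (rule homI)
  fix a b assume "a \<in> carrier (semidirect V \<phi> K)" "b \<in> carrier (semidirect V \<phi> K)"
  then obtain v w k l t v' w' k' l' t' where
    a: "a = ((v, w), ((k, l), t))" and b: "b = ((v', w'), ((k', l'), t'))"
    and c: "(k', l') \<in> carrier M" "0 \<le> v'" "v' < int p" "0 \<le> w'" "w' < int p"
    by (auto simp: semidirect_def K_def)
  have "a \<otimes>\<^bsub>semidirect V \<phi> K\<^esub> b =
      (((v + \<omega> k * v') mod int p, (w + \<omega> l * w') mod int p),
        (((k + k') mod int (p - 1), (l + l') mod int (p - 1)), (t + t') mod int q))"
    using c by (simp add: a b semidirect_def K_def \<phi>_def \<psi>_def diag_apply mod_simps)
  hence "aut (a \<otimes>\<^bsub>semidirect V \<phi> K\<^esub> b) =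
      aut ((v + \<omega> k * v', w + \<omega> l * w'), ((k + k', l + l'), t + t'))"
    by (simp only:) (rule aut_cong; rule mod_eq_dvd_iff[THEN iffD1]; rule mod_mod_trivial)
  also have "\<dots> = aut a \<otimes>\<^bsub>AutoGroup H\<^esub> aut b"
    unfolding a b aut_compose by (simp add: mult_AutoGroup aut_in_AutoGroup)
  finally show "aut (a \<otimes>\<^bsub>semidirect V \<phi> K\<^esub> b) = aut a \<otimes>\<^bsub>AutoGroup H\<^esub> aut b" .
qed (rule aut_in_AutoGroup)

text \<open>
  Together with its companion below this says that \<open>1 - \<omega> x\<close> is a unit modulo \<open>p\<close>, so that
  \<open>w \<mapsto> w - D w\<close> is bijective on \<open>V\<close>. Injectivity gives uniqueness of the conjugating element,
  surjectivity its existence.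
\<close>

lemma omega_factor_dvd:
  assumes "int p dvd u * (1 - \<omega> x)" "\<not> int (p - 1) dvd x"
  shows "int p dvd u"
proof -
  have "\<not> int p dvd 1 - \<omega> x"
  proof
    assume "int p dvd 1 - \<omega> x"
    hence "\<omega> 0 = \<omega> x" using omega_mod by (metis mod_eq_dvd_iff omega_0)
    thus False using assms(2) omega_inj[of x 0] by simp
  qed
  thus ?thesis using assms(1) prime_p by (simp add: prime_dvd_mult_iff)
qed

lemma omega_factor_solve:
  assumes "\<not> int (p - 1) dvd x"
  obtains w where "0 \<le> w" "w < int p" "(w - \<omega> x * w) mod int p = v mod int p"
proof -
  have "\<not> int p dvd 1 - \<omega> x" using omega_factor_dvd[of 1 x] assms prime_p by auto
  hence "coprime (1 - \<omega> x) (int p)"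
    using prime_p by (simp add: prime_imp_coprime coprime_commute)
  then obtain w where w: "[(1 - \<omega> x) * w = v] (mod int p)"
    using cong_solve_coprime_int[of "1 - \<omega> x" "int p"] by (metis cong_scalar_right mult.assoc mult_1)
  have "[w mod int p - \<omega> x * (w mod int p) = w - \<omega> x * w] (mod int p)"
    by (intro cong_diff cong_mult cong_refl cong_mod_self)
  also have "w - \<omega> x * w = (1 - \<omega> x) * w" by (simp add: algebra_simps)
  also note w
  finally show ?thesis using that[of "w mod int p"] by (simp add: cong_def)
qed

lemma chi_nontrivial: "\<not> int (p - 1) dvd \<kappa> * 1" "\<not> int (p - 1) dvd \<kappa> * (int n * 1)"
  using n_not_dvd(1) prime_q prime_gt_1_nat[of q] unfolding kappa_dvd_iff by auto

text \<open>
  The three elements generate \<open>H\<close>, by \<open>H_factor\<close>.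
\<close>

lemma AutoGroup_H_eqI:
  assumes f: "f \<in> carrier (AutoGroup H)" and g: "g \<in> carrier (AutoGroup H)"
    and A: "f ((0, 0), 1) = g ((0, 0), 1)" and B: "f ((1, 0), 0) = g ((1, 0), 0)"
    and C: "f ((0, 1), 0) = g ((0, 1), 0)"
  shows "f = g"
proof
  interpret H: group H by (rule group_H)
  have pow: "h (x [^]\<^bsub>H\<^esub> (k::int)) = h x [^]\<^bsub>H\<^esub> k"
    if "h \<in> carrier (AutoGroup H)" "x \<in> carrier H" for h x k
    using that group_H by (intro hom_int_pow) (auto simp: carrier_AutoGroup_iff)
  have mult: "h (x \<otimes>\<^bsub>H\<^esub> y) = h x \<otimes>\<^bsub>H\<^esub> h y"
    if "h \<in> carrier (AutoGroup H)" "x \<in> carrier H" "y \<in> carrier H" for h x y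
    using that by (auto simp: carrier_AutoGroup_iff hom_mult)
  fix u
  show "f u = g u"
  proof (cases "u \<in> carrier H")
    case True
    obtain x y i where u: "u = ((x, y), i)" by (metis prod.collapse)
    show ?thesis
      using f g gens_in_carrier_H unfolding u
      by (subst (1 2) H_factor[OF True[unfolded u]]) (simp add: mult pow A B C)
  next
    case False
    have "f \<in> extensional (carrier H)" "g \<in> extensional (carrier H)"
      using f g by (blast dest: carrier_AutoGroup_iff[THEN iffD1])+
    thus ?thesis by (metis False extensional_arb)
  qed
qed

lemma aut_gens:
  "aut ((v, w), ((k, l), t)) ((0, 0), 1) =
    (((v - \<omega> (\<kappa> * 1) * v) mod int p, (w - \<omega> (\<kappa> * (int n * 1)) * w) mod int p),
      (1 + int q * t) mod (int q)\<^sup>2)"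
  "aut ((v, w), ((k, l), t)) ((1, 0), 0) = ((\<omega> k, 0), 0)"
  "aut ((v, w), ((k, l), t)) ((0, 1), 0) = ((0, \<omega> l), 0)"
  unfolding gens_in_carrier_H[THEN aut_apply] by (simp_all add: omega_0 omega_mod \<chi>_def \<chi>'_def)

lemma aut_inj: "inj_on aut (carrier (semidirect V \<phi> K))"
proof (rule inj_onI)
  fix a b assume "a \<in> carrier (semidirect V \<phi> K)" "b \<in> carrier (semidirect V \<phi> K)" and eq: "aut a = aut b"
  then obtain v w k l t v' w' k' l' t' where
    a: "a = ((v, w), ((k, l), t))" and b: "b = ((v', w'), ((k', l'), t'))"
    and V: "{v, w, v', w'} \<subseteq> {0..<int p}" and M: "{k, l, k', l'} \<subseteq> {0..<int (p - 1)}"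
    and t: "{t, t'} \<subseteq> {0..<int q}"
    using q_pos p_gt_1 by (auto simp: semidirect_def K_def carrier_integer_mod_group)
  have res: "x = y" if "m dvd x - y" "0 \<le> x" "x < m" "0 \<le> y" "y < m" for m x y :: int
    using that by (metis mod_eq_dvd_iff mod_pos_pos_trivial)
  have factor: "x = y"
    if "(x - \<omega> z * x) mod int p = (y - \<omega> z * y) mod int p" "\<not> int (p - 1) dvd z"
      "{x, y} \<subseteq> {0..<int p}" for x y z
  proof -
    have "(x - \<omega> z * x) - (y - \<omega> z * y) = (x - y) * (1 - \<omega> z)" by (simp add: algebra_simps)
    hence "int p dvd (x - y) * (1 - \<omega> z)" using that(1) by (simp only: mod_eq_dvd_iff)
    hence "int p dvd x - y" using that(2) by (rule omega_factor_dvd)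
    thus ?thesis using that(3) by (intro res) auto
  qed
  have A: "((v - \<omega> (\<kappa> * 1) * v) mod int p, (w - \<omega> (\<kappa> * (int n * 1)) * w) mod int p) =
      ((v' - \<omega> (\<kappa> * 1) * v') mod int p, (w' - \<omega> (\<kappa> * (int n * 1)) * w') mod int p)"
    "(1 + int q * t) mod (int q)\<^sup>2 = (1 + int q * t') mod (int q)\<^sup>2"
    using arg_cong[OF eq, of "\<lambda>f. f ((0, 0), 1)"] unfolding a b aut_gens by (simp_all only: prod.inject)
  have "\<omega> k = \<omega> k'" "\<omega> l = \<omega> l'"
    using arg_cong[OF eq, of "\<lambda>f. f ((1, 0), 0)"] arg_cong[OF eq, of "\<lambda>f. f ((0, 1), 0)"]
    unfolding a b aut_gens by simp_all
  hence "k = k'" "l = l'" using M unfolding omega_inj by (auto intro: res)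
  moreover have "v = v'" "w = w'"
    using A(1) V by (auto intro: factor[OF _ chi_nontrivial(1)] factor[OF _ chi_nontrivial(2)] simp del: mult_1_right)
  moreover have "int q * int q dvd int q * (t - t')"
    using A(2) by (simp add: mod_eq_dvd_iff power2_eq_square right_diff_distrib)
  hence "int q dvd t - t'" using q_pos by simp
  hence "t = t'" using t by (intro res) auto
  ultimately show "a = b" by (simp add: a b)
qed

text \<open>
  An element of \<open>V\<close> is killed by \<open>p\<close>, hence so is its image, and \<open>p\<close> is invertible modulo the order
  \<open>q\<^sup>2\<close> of the cyclic factor.
\<close>

lemma AutoGroup_preserves_V:
  assumes f: "f \<in> carrier (AutoGroup H)" and u: "((x, y), 0) \<in> carrier H"
  obtains x' y' where "f ((x, y), 0) = ((x', y'), 0)" "((x', y'), 0) \<in> carrier H"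
proof -
  interpret H: group H by (rule group_H)
  obtain x' y' i where fu: "f ((x, y), 0) = ((x', y'), i)" by (metis prod.collapse)
  have fc: "((x', y'), i) \<in> carrier H"
    using f u fu by (auto simp: carrier_AutoGroup_iff hom_def Pi_def) (metis u)
  have fhom: "f \<in> hom H H" using f by (simp add: carrier_AutoGroup_iff)
  have "((x', y'), i) [^]\<^bsub>H\<^esub> int p = f (((x, y), 0) [^]\<^bsub>H\<^esub> int p)"
    using hom_int_pow[OF fhom u group_H group_H] by (simp add: fu)
  also have "((x, y), 0) [^]\<^bsub>H\<^esub> int p = \<one>\<^bsub>H\<^esub>"
    using u by (simp add: V_int_pow carrier_H one_H)
  finally have "((x', y'), i) [^]\<^bsub>H\<^esub> int p = ((0, 0), 0)"
    using hom_one[OF fhom group_H group_H] by (simp add: one_H)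
  moreover have "snd \<in> hom H (integer_mod_group (q\<^sup>2))"
    by (intro homI) (auto simp: H_def semidirect_def)
  hence "snd (((x', y'), i) [^]\<^bsub>H\<^esub> int p) = int p * i mod (int q)\<^sup>2"
    using hom_int_pow[of snd H "integer_mod_group (q\<^sup>2)" "((x', y'), i)" "int p"] fc group_H
    by (simp add: int_pow_integer_mod_group)
  ultimately have "(int q)\<^sup>2 dvd int p * i" by (simp add: mod_eq_0_iff_dvd)
  moreover have "coprime ((int q)\<^sup>2) (int p)"
    using primes_coprime[OF prime_q prime_p] p_neq_q by simp
  ultimately have "(int q)\<^sup>2 dvd i" by (simp add: coprime_dvd_mult_right_iff)
  hence "i = 0" using fc by (auto simp: carrier_H) (metis dvd_imp_mod_0 mod_pos_pos_trivial)
  thus ?thesis using that fu fc by blast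
qed

text \<open>
  That \<open>u = (x, y)\<close> is an eigenvector of \<open>D\<close> for \<open>e\<close> means \<open>a u = u\<^sup>e a\<close>. Applying \<open>f\<close> to this equation
  makes the image of \<open>u\<close> an eigenvector of \<open>D\<^sup>i\<close> for \<open>e\<close>, since the \<open>V\<close>-part of \<open>f a\<close> commutes with
  \<open>V\<close>. The two coordinates of the eigenvector equation are stated separately, because \<open>b\<close> and \<open>c\<close>
  each have one vanishing coordinate.
\<close>

lemma AutoGroup_eigen:
  assumes f: "f \<in> carrier (AutoGroup H)" and u: "((x, y), 0) \<in> carrier H"
    and fA: "f ((0, 0), 1) = ((v, w), i)" and fu: "f ((x, y), 0) = ((x', y'), 0)"
    and u': "((x', y'), 0) \<in> carrier H"
    and eigen: "\<omega> (\<kappa> * 1) * x mod int p = e * x mod int p"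
      "\<omega> (\<kappa> * (int n * 1)) * y mod int p = e * y mod int p"
  shows "\<omega> (\<kappa> * i) * x' mod int p = e * x' mod int p"
    "\<omega> (\<kappa> * (int n * i)) * y' mod int p = e * y' mod int p"
proof -
  interpret H: group H by (rule group_H)
  have fhom: "f \<in> hom H H" using f by (simp add: carrier_AutoGroup_iff)
  have bd: "0 \<le> x" "x < int p" "0 \<le> y" "y < int p" "0 \<le> x'" "x' < int p" "0 \<le> y'" "y' < int p"
    using u u' by (auto simp: carrier_H)
  have Ac: "((0, 0), 1) \<in> carrier H" by (rule gens_in_carrier_H)
  have fAc: "((v, w), i) \<in> carrier H" using hom_in_carrier[OF fhom Ac] by (simp add: fA)
  hence i: "i mod (int q)\<^sup>2 = i" by (simp add: carrier_H)
  have "((0, 0), 1) \<otimes>\<^bsub>H\<^esub> ((x, y), 0) = ((x, y), 0) [^]\<^bsub>H\<^esub> e \<otimes>\<^bsub>H\<^esub> ((0, 0), 1)"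
    using bd eigen by (simp add: mult_H V_int_pow \<chi>_def \<chi>'_def)
  hence "f ((0, 0), 1) \<otimes>\<^bsub>H\<^esub> f ((x, y), 0) = f ((x, y), 0) [^]\<^bsub>H\<^esub> e \<otimes>\<^bsub>H\<^esub> f ((0, 0), 1)"
    using u Ac hom_mult[OF fhom] hom_int_pow[OF fhom u group_H group_H, of e] by (metis H.int_pow_closed)
  hence "(v + \<chi> i * x') mod int p = (e * x' + v) mod int p"
    "(w + \<chi>' i * y') mod int p = (e * y' + w) mod int p"
    using bd fAc by (simp_all add: fA fu mult_H V_int_pow chi_0 carrier_H mod_simps)
  thus "\<omega> (\<kappa> * i) * x' mod int p = e * x' mod int p"
    "\<omega> (\<kappa> * (int n * i)) * y' mod int p = e * y' mod int p"
    by (simp_all add: mod_eq_dvd_iff \<chi>_def \<chi>'_def algebra_simps)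
qed

lemma AutoGroup_nontrivial:
  assumes f: "f \<in> carrier (AutoGroup H)" and u: "g \<in> carrier H" "g \<noteq> \<one>\<^bsub>H\<^esub>"
  shows "f g \<noteq> \<one>\<^bsub>H\<^esub>"
proof
  assume "f g = \<one>\<^bsub>H\<^esub>"
  moreover have "f \<one>\<^bsub>H\<^esub> = \<one>\<^bsub>H\<^esub>" and "inj_on f (carrier H)"
    using f hom_one[OF _ group_H group_H] by (auto simp: carrier_AutoGroup_iff bij_betw_def)
  ultimately show False
    using u group.is_monoid[OF group_H] by (metis inj_onD monoid.one_closed)
qed

text \<open>
  The eigenvector equations for the images of \<open>b\<close> and \<open>c\<close> yield the congruences for \<open>i\<close> and \<open>n\<close> that
  rule out everything but a diagonal matrix. The remaining parameters come from discrete
  logarithms, from \<open>omega_factor_solve\<close> and from \<open>i \<equiv> 1\<close> modulo \<open>q\<close>.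
\<close>

lemma aut_surj:
  assumes f: "f \<in> carrier (AutoGroup H)"
  shows "\<exists>z \<in> carrier (semidirect V \<phi> K). aut z = f"
proof -
  obtain b1 b2 where B: "f ((1, 0), 0) = ((b1, b2), 0)" "((b1, b2), 0) \<in> carrier H"
    using AutoGroup_preserves_V[OF f gens_in_carrier_H(2)] by blast
  obtain c1 c2 where C: "f ((0, 1), 0) = ((c1, c2), 0)" "((c1, c2), 0) \<in> carrier H"
    using AutoGroup_preserves_V[OF f gens_in_carrier_H(3)] by blast
  obtain v w i where A: "f ((0, 0), 1) = ((v, w), i)" by (metis prod.collapse)
  have Ac: "((v, w), i) \<in> carrier H"
    using f gens_in_carrier_H(1) A by (metis carrier_AutoGroup_iff hom_in_carrier)
  have small: "int p dvd u \<longleftrightarrow> u = 0" if "0 \<le> u" "u < int p" for u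
    using that by (metis dvd_0_right dvd_imp_mod_0 mod_pos_pos_trivial)
  have bd: "0 \<le> b1" "b1 < int p" "0 \<le> b2" "b2 < int p" "0 \<le> c1" "c1 < int p" "0 \<le> c2" "c2 < int p"
    "0 \<le> v" "v < int p" "0 \<le> w" "w < int p" "0 \<le> i" "i < (int q)\<^sup>2"
    using B C Ac by (auto simp: carrier_H)
  note eB = AutoGroup_eigen[OF f gens_in_carrier_H(2) A B, of "\<omega> (\<kappa> * 1)"]
  note eC = AutoGroup_eigen[OF f gens_in_carrier_H(3) A C, of "\<omega> (\<kappa> * (int n * 1))"]
  have dvd: "int q dvd s - s'" if "\<omega> (\<kappa> * s) * u mod int p = \<omega> (\<kappa> * s') * u mod int p" "u \<noteq> 0"
    "0 \<le> u" "u < int p" for s s' u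
  proof -
    have "int (p - 1) dvd \<kappa> * s - \<kappa> * s'"
      by (rule omega_cancel[OF that(1)]) (use that(2-4) small in blast)
    thus ?thesis unfolding right_diff_distrib[symmetric] kappa_dvd_iff .
  qed
  have b1: "b1 \<noteq> 0 \<Longrightarrow> int q dvd i - 1" and b2: "b2 \<noteq> 0 \<Longrightarrow> int q dvd int n * i - 1"
    using eB bd by (auto intro: dvd)
  have c1: "c1 \<noteq> 0 \<Longrightarrow> int q dvd i - int n" and c2: "c2 \<noteq> 0 \<Longrightarrow> int q dvd int n * i - int n"
    using eC bd by (auto intro: dvd simp del: mult_1_right) (metis dvd mult_1_right)+
  have ni: "int q dvd i - 1" if "int q dvd int n * i - int n"
  proof -
    have "int q dvd int n * (i - 1)" using that by (simp add: algebra_simps)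
    thus ?thesis using n_not_dvd(1) prime_q by (simp add: prime_dvd_mult_iff)
  qed
  have n1: "\<not> int q dvd int n - 1"
  proof
    assume "int q dvd int n - 1"
    hence "int q dvd (int n - 1) * (int n + 1)" by (rule dvd_mult2)
    thus False using n_not_dvd(2) by (simp add: algebra_simps)
  qed
  have nB: "b1 \<noteq> 0 \<or> b2 \<noteq> 0"
    using AutoGroup_nontrivial[OF f gens_in_carrier_H(2)] by (auto simp: B one_H)
  have nC: "c1 \<noteq> 0 \<or> c2 \<noteq> 0"
    using AutoGroup_nontrivial[OF f gens_in_carrier_H(3)] by (auto simp: C one_H)
  \<comment> \<open>Otherwise \<open>f\<close> exchanges the two eigenlines, whence \<open>n\<^sup>2 \<equiv> n i \<equiv> 1\<close>.\<close>
  have i1: "int q dvd i - 1"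
  proof (rule ccontr)
    assume "\<not> int q dvd i - 1"
    hence "int q dvd int n * i - 1" "int q dvd i - int n" using b1 b2 c1 c2 ni nB nC by blast+
    hence "int q dvd (int n * i - 1) - int n * (i - int n)" by (meson dvd_diff dvd_mult)
    thus False using n_not_dvd(2) by (simp add: algebra_simps)
  qed
  have "b2 = 0"
  proof (rule ccontr)
    assume "b2 \<noteq> 0"
    hence "int q dvd (int n * i - 1) - int n * (i - 1)" using b2 i1 by (meson dvd_diff dvd_mult)
    thus False using n1 by (simp add: algebra_simps)
  qed
  have "c1 = 0"
  proof (rule ccontr)
    assume "c1 \<noteq> 0"
    hence "int q dvd (i - 1) - (i - int n)" using c1 i1 by (meson dvd_diff)
    thus False using n1 by (simp add: algebra_simps)
  qed
  have onto: "\<exists>k. 0 \<le> k \<and> k < int (p - 1) \<and> \<omega> k = u" if "u \<noteq> 0" "0 \<le> u" "u < int p" for u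
  proof -
    have "\<not> int p dvd u" "u mod int p = u" using small[of u] that by simp_all
    then obtain x where x: "\<omega> x = u" using omega_onto[of u] by auto
    have "\<omega> (x mod int (p - 1)) = \<omega> x"
      unfolding omega_inj by (rule mod_eq_dvd_iff[THEN iffD1]) (rule mod_mod_trivial)
    moreover have "0 < int (p - 1)" using p_gt_1 by simp
    hence "0 \<le> x mod int (p - 1)" "x mod int (p - 1) < int (p - 1)"
      by (rule pos_mod_sign, rule pos_mod_bound)
    ultimately show ?thesis unfolding x by blast
  qed
  obtain k where k: "0 \<le> k" "k < int (p - 1)" "\<omega> k = b1"
    using onto[of b1] nB bd \<open>b2 = 0\<close> by auto
  obtain l where l: "0 \<le> l" "l < int (p - 1)" "\<omega> l = c2"
    using onto[of c2] nC bd \<open>c1 = 0\<close> by auto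
  obtain v' where v': "0 \<le> v'" "v' < int p" "(v' - \<omega> (\<kappa> * 1) * v') mod int p = v mod int p"
    using omega_factor_solve[OF chi_nontrivial(1)] by blast
  obtain w' where w': "0 \<le> w'" "w' < int p" "(w' - \<omega> (\<kappa> * (int n * 1)) * w') mod int p = w mod int p"
    using omega_factor_solve[OF chi_nontrivial(2)] by blast
  obtain t where t: "i - 1 = int q * t" using i1 by (auto simp: dvd_def)
  have "int q * t < int q * int q" using t bd(14) by (simp add: power2_eq_square)
  hence "t < int q" using q_pos by simp
  moreover have "\<not> t < 0"
  proof
    assume "t < 0"
    hence "int q * t \<le> int q * (- 1)" using q_pos by (intro mult_left_mono) auto
    thus False using t bd(13) prime_q prime_gt_1_nat[of q] by simp
  qed
  ultimately have "((v', w'), ((k, l), t)) \<in> carrier (semidirect V \<phi> K)"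
    using v' w' k l p_gt_1 q_pos by (simp add: semidirect_def K_def carrier_integer_mod_group)
  moreover have "aut ((v', w'), ((k, l), t)) = f"
  proof (rule AutoGroup_H_eqI[OF aut_in_AutoGroup f])
    have "1 + int q * t = i" using t by simp
    thus "aut ((v', w'), ((k, l), t)) ((0, 0), 1) = f ((0, 0), 1)"
      unfolding aut_gens A v'(3) w'(3) using bd by simp
  qed (simp_all add: aut_gens B C k l \<open>b2 = 0\<close> \<open>c1 = 0\<close>)
  ultimately show ?thesis by blast
qed

theorem AutoGroup_H_iso: "AutoGroup H \<cong> semidirect V \<phi> K"
proof -
  have "aut ` carrier (semidirect V \<phi> K) = carrier (AutoGroup H)"
    using aut_surj aut_in_AutoGroup by blast
  hence "aut \<in> iso (semidirect V \<phi> K) (AutoGroup H)"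
    using aut_inj aut_in_hom by (simp add: iso_iff)
  moreover have "group (semidirect V \<phi> K)"
    using group_V psi_hom phi_hom unfolding K_def
    by (intro group_semidirect DirProd_group) simp_all
  ultimately show ?thesis by (meson group.iso_sym is_isoI)
qed

section \<open>The presented group\<close>

text \<open>
  By von Dyck's theorem \<open>a\<close>, \<open>b\<close>, \<open>c\<close> may be sent to the generators of \<open>H\<close>. The presentation
  prescribes \<open>a\<^sup>-\<^sup>1 b a = b\<^sup>r\<close>, whereas \<open>H\<close> is built from the action \<open>u \<mapsto> a u a\<^sup>-\<^sup>1\<close>; this is why
  \<open>\<omega> \<kappa>\<close> is the inverse of \<open>r\<close>. On normal forms the map reads off the exponents modulo \<open>p\<close>, \<open>p\<close> and
  \<open>q\<^sup>2\<close>, so its kernel is trivial.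
\<close>

lemma presentation_iso:
  assumes r: "[r * \<omega> \<kappa> = 1] (mod int p)" and r': "[r ^ n * \<omega> (\<kappa> * int n) = 1] (mod int p)"
  shows "presented_group (rels p q r n) \<cong> H"
proof -
  let ?R = "rels p q r n"
  let ?G = "presented_group ?R"
  interpret G: group ?G by (rule group_presented_group)
  interpret H: group H by (rule group_H)
  define A B C where "A = (((0, 0), 1) :: (int \<times> int) \<times> int)" and "B = (((1, 0), 0) :: (int \<times> int) \<times> int)"
    and "C = (((0, 1), 0) :: (int \<times> int) \<times> int)"
  have cl: "A \<in> carrier H" "B \<in> carrier H" "C \<in> carrier H"
    unfolding A_def B_def C_def by (rule gens_in_carrier_H)+
  have pow: "A [^]\<^bsub>H\<^esub> (k::int) = ((0, 0), k mod (int q)\<^sup>2)" "B [^]\<^bsub>H\<^esub> k = ((k mod int p, 0), 0)"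
    "C [^]\<^bsub>H\<^esub> k = ((0, k mod int p), 0)" for k
    by (simp_all add: A_def B_def C_def A_int_pow V_int_pow)
  define f where "f = case_abc A B C"
  have f: "f x \<in> carrier H" for x using cl by (cases x) (simp_all add: f_def)
  have gen: "H.eval_word f (gen x) = f x" for x by (rule H.eval_word_gen[of f x, OF f])
  have q2: "1 < (int q)\<^sup>2" using prime_q prime_gt_1_nat[of q] by (simp add: one_less_power)
  have "\<chi> 1 * r mod int p = 1" "\<chi>' 1 * r ^ n mod int p = 1"
    using r r' by (simp_all add: cong_def \<chi>_def \<chi>'_def mult.commute)
  hence BA: "B \<otimes>\<^bsub>H\<^esub> A = A \<otimes>\<^bsub>H\<^esub> B [^]\<^bsub>H\<^esub> r" and CA: "C \<otimes>\<^bsub>H\<^esub> A = A \<otimes>\<^bsub>H\<^esub> C [^]\<^bsub>H\<^esub> (r ^ n)"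
    using q2 by (simp_all add: pow) (simp_all add: A_def B_def C_def mult_H mod_simps)
  have conj: "inv\<^bsub>H\<^esub> A \<otimes>\<^bsub>H\<^esub> (X \<otimes>\<^bsub>H\<^esub> A) = Y" if "X \<otimes>\<^bsub>H\<^esub> A = A \<otimes>\<^bsub>H\<^esub> Y" "Y \<in> carrier H" for X Y
    using that cl by (simp add: H.m_assoc[symmetric])
  have rel: "H.eval_word f u = H.eval_word f v" if "(u, v) \<in> ?R" for u v
  proof -
    have nil: "H.eval_word f [] = \<one>\<^bsub>H\<^esub>" by (simp add: H.eval_word_def)
    have "H.eval_word f (wpow (gen abc.a) (int (q ^ 2))) = \<one>\<^bsub>H\<^esub>"
      "H.eval_word f (wpow (gen abc.b) (int p)) = \<one>\<^bsub>H\<^esub>"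
      "H.eval_word f (wpow (gen abc.c) (int p)) = \<one>\<^bsub>H\<^esub>"
      unfolding H.eval_word_wpow[OF f] gen by (simp_all add: f_def pow one_H)
    moreover have "H.eval_word f (wcomm (gen abc.b) (gen abc.c)) = \<one>\<^bsub>H\<^esub>"
      unfolding H.eval_word_wcomm_eq_one_iff[OF f] gen
      by (simp add: f_def B_def C_def mult_H chi_0)
    moreover have "H.eval_word f (winv (gen abc.a) @ gen abc.b @ gen abc.a) = H.eval_word f (wpow (gen abc.b) r)"
      "H.eval_word f (winv (gen abc.a) @ gen abc.c @ gen abc.a) = H.eval_word f (wpow (gen abc.c) (r ^ n))"
      unfolding H.eval_word_append[OF f] H.eval_word_winv[OF f] H.eval_word_wpow[OF f] gen
      using conj[OF BA] conj[OF CA] cl by (simp_all add: f_def)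
    ultimately show ?thesis using that unfolding rels_def by (auto simp only: nil insert_iff empty_iff prod.inject)
  qed
  obtain h where h: "h \<in> hom ?G H" and hgen: "\<And>x. h (pres_class ?R (gen x)) = f x"
    using H.presented_group_universal[OF f rel] by blast
  define A' B' C' where "A' = pres_class ?R (gen abc.a)" and "B' = pres_class ?R (gen abc.b)"
    and "C' = pres_class ?R (gen abc.c)"
  have cl': "A' \<in> carrier ?G" "B' \<in> carrier ?G" "C' \<in> carrier ?G"
    by (simp_all add: A'_def B'_def C'_def presented_group_carrier)
  have hX: "h A' = A" "h B' = B" "h C' = C"
    by (simp_all add: A'_def B'_def C'_def hgen f_def)
  have h_normal: "h (B' [^]\<^bsub>?G\<^esub> j \<otimes>\<^bsub>?G\<^esub> C' [^]\<^bsub>?G\<^esub> k \<otimes>\<^bsub>?G\<^esub> A' [^]\<^bsub>?G\<^esub> i) =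
      ((j mod int p, k mod int p), i mod (int q)\<^sup>2)" for i j k :: int
  proof -
    have "h (B' [^]\<^bsub>?G\<^esub> j \<otimes>\<^bsub>?G\<^esub> C' [^]\<^bsub>?G\<^esub> k \<otimes>\<^bsub>?G\<^esub> A' [^]\<^bsub>?G\<^esub> i) =
        B [^]\<^bsub>H\<^esub> j \<otimes>\<^bsub>H\<^esub> C [^]\<^bsub>H\<^esub> k \<otimes>\<^bsub>H\<^esub> A [^]\<^bsub>H\<^esub> i"
      using cl' hom_int_pow[OF h _ G.is_group H.is_group] by (simp add: hom_mult[OF h] hX)
    thus ?thesis by (simp add: pow mult_H chi_0)
  qed
  define e where "e = (\<lambda>x. pres_class ?R (gen x))"
  have e: "e x \<in> carrier ?G" for x by (simp add: e_def presented_group_carrier)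
  have e_cases: "e = case_abc A' B' C'"
    by (rule ext) (simp add: e_def A'_def B'_def C'_def split: abc.split)
  have ev: "G.eval_word e w = pres_class ?R w" for w
    unfolding e_def by (rule eval_word_pres_class)
  have egen: "G.eval_word e (gen x) = e x" for x by (rule G.eval_word_gen[of e x, OF e])
  have relG: "G.eval_word e u = G.eval_word e v" if "(u, v) \<in> ?R" for u v
    unfolding ev pres_class_eq_iff using that by (rule pres_eq.rel)
  have nil: "G.eval_word e [] = \<one>\<^bsub>?G\<^esub>" by (simp add: G.eval_word_def)
  have R: "(wpow (gen abc.a) (int (q ^ 2)), []) \<in> ?R" "(wpow (gen abc.b) (int p), []) \<in> ?R"
    "(wpow (gen abc.c) (int p), []) \<in> ?R" "(wcomm (gen abc.b) (gen abc.c), []) \<in> ?R"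
    "(winv (gen abc.a) @ gen abc.b @ gen abc.a, wpow (gen abc.b) r) \<in> ?R"
    "(winv (gen abc.a) @ gen abc.c @ gen abc.a, wpow (gen abc.c) (r ^ n)) \<in> ?R"
    by (simp_all add: rels_def)
  have ord: "A' [^]\<^bsub>?G\<^esub> int (q ^ 2) = \<one>\<^bsub>?G\<^esub>" "B' [^]\<^bsub>?G\<^esub> int p = \<one>\<^bsub>?G\<^esub>"
      "C' [^]\<^bsub>?G\<^esub> int p = \<one>\<^bsub>?G\<^esub>"
    using R(1-3)[THEN relG] unfolding nil G.eval_word_wpow[OF e] egen
    by (simp_all only: e_cases abc.case)
  have comm: "B' \<otimes>\<^bsub>?G\<^esub> C' = C' \<otimes>\<^bsub>?G\<^esub> B'"
    using R(4)[THEN relG] unfolding nil G.eval_word_wcomm_eq_one_iff[OF e] egen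
    by (simp only: e_cases abc.case)
  have "inv\<^bsub>?G\<^esub> A' \<otimes>\<^bsub>?G\<^esub> (B' \<otimes>\<^bsub>?G\<^esub> A') = B' [^]\<^bsub>?G\<^esub> r"
    "inv\<^bsub>?G\<^esub> A' \<otimes>\<^bsub>?G\<^esub> (C' \<otimes>\<^bsub>?G\<^esub> A') = C' [^]\<^bsub>?G\<^esub> (r ^ n)"
    using R(5,6)[THEN relG]
    unfolding G.eval_word_append[OF e] G.eval_word_winv[OF e] G.eval_word_wpow[OF e] egen
    by (simp_all only: e_cases abc.case)
  hence conj': "inv\<^bsub>?G\<^esub> A' \<otimes>\<^bsub>?G\<^esub> B' \<otimes>\<^bsub>?G\<^esub> A' = B' [^]\<^bsub>?G\<^esub> r"
    "inv\<^bsub>?G\<^esub> A' \<otimes>\<^bsub>?G\<^esub> C' \<otimes>\<^bsub>?G\<^esub> A' = C' [^]\<^bsub>?G\<^esub> (r ^ n)"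
    using cl' by (simp_all add: G.m_assoc)
  have kernel: "g = \<one>\<^bsub>?G\<^esub>" if g: "g \<in> carrier ?G" "h g = \<one>\<^bsub>H\<^esub>" for g
  proof -
    obtain w where "g = pres_class ?R w" using g(1) by (auto simp: presented_group_carrier)
    moreover obtain i j k :: int where "pres_class ?R w =
        B' [^]\<^bsub>?G\<^esub> j \<otimes>\<^bsub>?G\<^esub> C' [^]\<^bsub>?G\<^esub> k \<otimes>\<^bsub>?G\<^esub> A' [^]\<^bsub>?G\<^esub> i"
      using G.normal_form[OF cl' ord(2,3) comm conj' r r', of w]
      unfolding e_cases[symmetric] ev by blast
    ultimately have g': "g = B' [^]\<^bsub>?G\<^esub> j \<otimes>\<^bsub>?G\<^esub> C' [^]\<^bsub>?G\<^esub> k \<otimes>\<^bsub>?G\<^esub> A' [^]\<^bsub>?G\<^esub> i" by simp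
    have "[j = 0] (mod int p)" "[k = 0] (mod int p)" "[i = 0] (mod int (q ^ 2))"
      using g(2) unfolding g' h_normal one_H by (simp_all add: cong_def)
    from G.int_pow_cong[OF cl'(2) ord(2) this(1)] G.int_pow_cong[OF cl'(3) ord(3) this(2)]
      G.int_pow_cong[OF cl'(1) ord(1) this(3)]
    have "B' [^]\<^bsub>?G\<^esub> j = B' [^]\<^bsub>?G\<^esub> (0::int)" "C' [^]\<^bsub>?G\<^esub> k = C' [^]\<^bsub>?G\<^esub> (0::int)"
      "A' [^]\<^bsub>?G\<^esub> i = A' [^]\<^bsub>?G\<^esub> (0::int)"
      .
    thus ?thesis by (simp add: g')
  qed
  interpret hGH: group_hom ?G H h
    using h by (simp add: group_hom_def group_hom_axioms_def G.is_group H.is_group)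
  have "inj_on h (carrier ?G)" using kernel by (simp add: hGH.inj_on_one_iff)
  moreover have "h ` carrier ?G = carrier H"
  proof
    show "carrier H \<subseteq> h ` carrier ?G"
    proof
      fix u assume "u \<in> carrier H"
      then obtain x y i where "u = ((x mod int p, y mod int p), i mod (int q)\<^sup>2)"
        by (auto simp: carrier_H) (metis mod_pos_pos_trivial)
      thus "u \<in> h ` carrier ?G" unfolding h_normal[symmetric]
        by (simp only:) (intro imageI G.m_closed G.int_pow_closed cl')
    qed
  qed (use hGH.hom_closed in blast)
  ultimately show ?thesis using h by (intro is_isoI[of h]) (simp add: iso_iff)
qed

end

section \<open>Discrete exponentials\<close>

text \<open>
  Powers of a primitive root, with the exponent reduced modulo \<open>p - 1\<close> to allow negative exponents.
\<close>

lemma discrete_exponential_exists: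
  assumes p: "prime p"
  shows "\<exists>\<omega> :: int \<Rightarrow> int. \<omega> 0 = 1 \<and> (\<forall>x y. \<omega> (x + y) = \<omega> x * \<omega> y mod int p) \<and>
    (\<forall>x y. \<omega> x = \<omega> y \<longleftrightarrow> int (p - 1) dvd x - y) \<and>
    (\<forall>z. \<not> int p dvd z \<longrightarrow> (\<exists>x. \<omega> x = z mod int p))"
proof -
  have p1: "p > 1" using p by (rule prime_gt_1_nat)
  hence pos: "0 < int (p - 1)" by simp
  obtain g where g: "residue_primroot p g"
    using prime_primitive_root_exists[OF p1 ] p by auto
  have cop: "coprime p g" and ord: "ord p g = p - 1"
    using g p by (simp_all add: residue_primroot_def totient_prime)
  define \<omega> where "\<omega> x = int (g ^ nat (x mod int (p - 1)) mod p)" for x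
  have pow: "g ^ a mod p = g ^ b mod p \<longleftrightarrow> [a = b] (mod (p - 1))" for a b
    using order_divides_expdiff[OF cop, of a b] by (simp add: ord cong_def)
  have "\<omega> 0 = 1" using p1 by (simp add: \<omega>_def)
  moreover have "\<omega> (x + y) = \<omega> x * \<omega> y mod int p" for x y
  proof -
    have "[nat ((x + y) mod int (p - 1)) = nat (x mod int (p - 1)) + nat (y mod int (p - 1))] (mod (p - 1))"
      using pos by (simp only: flip: cong_int_iff) (simp add: cong_def mod_simps)
    hence "g ^ nat ((x + y) mod int (p - 1)) mod p =
        g ^ (nat (x mod int (p - 1)) + nat (y mod int (p - 1))) mod p"
      unfolding pow .
    hence "\<omega> (x + y) = int (g ^ (nat (x mod int (p - 1)) + nat (y mod int (p - 1))) mod p)"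
      by (simp only: \<omega>_def)
    thus ?thesis by (simp add: \<omega>_def power_add zmod_int mod_simps)
  qed
  moreover have "\<omega> x = \<omega> y \<longleftrightarrow> int (p - 1) dvd x - y" for x y
  proof -
    have "\<omega> x = \<omega> y \<longleftrightarrow> [nat (x mod int (p - 1)) = nat (y mod int (p - 1))] (mod (p - 1))"
      unfolding \<omega>_def of_nat_eq_iff pow ..
    also have "\<dots> \<longleftrightarrow> x mod int (p - 1) = y mod int (p - 1)"
      using pos by (simp only: flip: cong_int_iff) (simp add: cong_def)
    finally show ?thesis by (simp only: mod_eq_dvd_iff)
  qed
  moreover have "\<exists>x. \<omega> x = z mod int p" if z: "\<not> int p dvd z" for z
  proof -
    have "0 \<le> z mod int p" "z mod int p < int p" "z mod int p \<noteq> 0"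
      using p1 z by (auto simp: mod_eq_0_iff_dvd)
    hence "nat (z mod int p) \<in> totatives p"
      using p by (simp add: totatives_prime nat_less_iff)
    hence "nat (z mod int p) \<in> (\<lambda>i. g ^ i mod p) ` {..<totient p}"
      unfolding bij_betw_imp_surj_on[OF residue_primroot_is_generator[OF p1 g]] .
    then obtain i where "i < totient p" "nat (z mod int p) = g ^ i mod p" by blast
    hence "\<omega> (int i) = int (nat (z mod int p))"
      using p p1 by (simp add: \<omega>_def totient_prime)
    also have "\<dots> = z mod int p" using \<open>0 \<le> z mod int p\<close> by simp
    finally have "\<omega> (int i) = z mod int p" .
    thus ?thesis by blast
  qed
  ultimately show ?thesis by blast
qed

theorem mainTheorem10:
  fixes p q n :: nat and r :: int
  assumes "prime p" and "prime q" and "p \<noteq> q" and "p * q \<noteq> 6" and "q \<noteq> 2"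
    and "q dvd p - 1"
    and "n \<in> {2..(q - 1) div 2}"
    and "[r ^ q = 1] (mod int p)" and "\<not> [r = 1] (mod int p)"
  defines "G \<equiv> presented_group (rels p q r n)"
  shows "\<exists>\<psi> \<in> hom (integer_mod_group q)
               (AutoGroup (integer_mod_group (p - 1) \<times>\<times> integer_mod_group (p - 1))).
         \<exists>\<phi> \<in> hom (semidirect (integer_mod_group (p - 1) \<times>\<times> integer_mod_group (p - 1)) \<psi>
                     (integer_mod_group q))
                  (AutoGroup (integer_mod_group p \<times>\<times> integer_mod_group p)).
           AutoGroup G \<cong>
             semidirect (integer_mod_group p \<times>\<times> integer_mod_group p) \<phi>
               (semidirect (integer_mod_group (p - 1) \<times>\<times> integer_mod_group (p - 1)) \<psi>
                  (integer_mod_group q))"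
proof -
  have p1: "p > 1" using assms(1) by (rule prime_gt_1_nat)
  obtain \<omega> :: "int \<Rightarrow> int" where "\<omega> 0 = 1 \<and> (\<forall>x y. \<omega> (x + y) = \<omega> x * \<omega> y mod int p) \<and>
    (\<forall>x y. \<omega> x = \<omega> y \<longleftrightarrow> int (p - 1) dvd x - y) \<and>
    (\<forall>z. \<not> int p dvd z \<longrightarrow> (\<exists>x. \<omega> x = z mod int p))"
    using discrete_exponential_exists[OF assms(1)] ..
  hence om: "\<omega> 0 = 1" "\<And>x y. \<omega> (x + y) = \<omega> x * \<omega> y mod int p"
    "\<And>x y. \<omega> x = \<omega> y \<longleftrightarrow> int (p - 1) dvd x - y"
    "\<And>z. \<not> int p dvd z \<Longrightarrow> \<exists>x. \<omega> x = z mod int p"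
    by simp_all
  have om_mod: "\<omega> x mod int p = \<omega> x" for x using om(2)[of x 0] by (simp add: om(1))
  have om_pow: "[\<omega> (x * int k) = \<omega> x ^ k] (mod int p)" for x k
    by (induction k) (simp_all add: om(1,2) cong_def mod_simps ring_distribs, metis mod_mult_right_eq)
  have om_neg: "[\<omega> x * \<omega> (- x) = 1] (mod int p)" for x
    using om(2)[of x "- x"] p1 by (simp add: om(1) cong_def)
  have "\<not> int p dvd r"
  proof
    assume "int p dvd r"
    hence "int p dvd r ^ q" using prime_gt_0_nat[OF assms(2)] by (meson dvd_power dvd_trans)
    thus False using assms(8) p1 by (metis cong_dvd_iff zdvd1_eq of_nat_1 abs_of_nat of_nat_eq_iff less_irrefl)
  qed
  then obtain \<rho> where rho: "\<omega> \<rho> = r mod int p" using om(4) by blast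
  hence r: "[r = \<omega> \<rho>] (mod int p)" by (simp add: cong_def)
  \<comment> \<open>The action of \<open>a\<close> is inverse to the one by \<open>r\<close>.\<close>
  define \<kappa> where "\<kappa> = - \<rho>"
  have "[\<omega> (\<rho> * int q) = 1] (mod int p)"
    using om_pow cong_pow[OF r, of q] assms(8) by (meson cong_sym cong_trans)
  hence "\<omega> (\<rho> * int q) = \<omega> 0" using p1 by (simp add: cong_def om_mod om(1))
  hence rho_q: "int (p - 1) dvd \<kappa> * int q" by (simp add: om(3) \<kappa>_def del: of_nat_diff)
  have "\<omega> \<rho> \<noteq> \<omega> 0" using assms(9) p1 by (auto simp: rho om(1) cong_def)
  hence kappa: "\<not> int (p - 1) dvd \<kappa>" unfolding om(3) by (simp add: \<kappa>_def)
  have kappa_iff: "int (p - 1) dvd \<kappa> * k \<longleftrightarrow> int q dvd k" for k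
  proof
    assume "int q dvd k"
    thus "int (p - 1) dvd \<kappa> * k" using rho_q by (meson dvd_trans mult_dvd_mono dvd_refl)
  next
    assume k: "int (p - 1) dvd \<kappa> * k"
    show "int q dvd k"
    proof (rule ccontr)
      assume "\<not> int q dvd k"
      hence "coprime (int q) k" using assms(2) by (simp add: prime_imp_coprime)
      hence "gcd (\<kappa> * int q) (\<kappa> * k) = \<bar>\<kappa>\<bar>" by (simp add: gcd_mult_distrib_int[symmetric] abs_mult)
      hence "int (p - 1) dvd \<bar>\<kappa>\<bar>" using rho_q k by (metis gcd_greatest)
      thus False using kappa by simp
    qed
  qed
  have n: "2 \<le> n" "2 * n < q" using assms(7) by auto
  have small: "\<not> int q dvd x" if "0 < x" "x < int q" for x
    using that by (simp add: zdvd_not_zless)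
  have "\<not> int q dvd int n * int n - 1"
  proof
    assume "int q dvd int n * int n - 1"
    hence "int q dvd (int n - 1) * (int n + 1)" by (simp add: algebra_simps)
    hence "int q dvd int n - 1 \<or> int q dvd int n + 1" using assms(2) by (simp add: prime_dvd_mult_iff)
    thus False using small[of "int n - 1"] small[of "int n + 1"] n by auto
  qed
  moreover have "\<not> int q dvd int n" using small[of "int n"] n by auto
  ultimately interpret diagonal_extension p q n \<omega> \<kappa>
    using assms(1-3) om kappa_iff by unfold_locales auto
  have "[r * \<omega> \<kappa> = 1] (mod int p)"
    using cong_mult[OF r cong_refl] om_neg unfolding \<kappa>_def by (rule cong_trans)
  moreover have "[r ^ n * \<omega> (\<kappa> * int n) = 1] (mod int p)"
  proof -
    have "[r ^ n = \<omega> (\<rho> * int n)] (mod int p)"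
      using cong_pow[OF r] om_pow by (meson cong_sym cong_trans)
    hence "[r ^ n * \<omega> (- (\<rho> * int n)) = \<omega> (\<rho> * int n) * \<omega> (- (\<rho> * int n))] (mod int p)"
      by (rule cong_mult) (rule cong_refl)
    from cong_trans[OF this om_neg] show ?thesis by (simp add: \<kappa>_def)
  qed
  ultimately have "G \<cong> H" unfolding G_def by (rule presentation_iso)
  hence "AutoGroup G \<cong> AutoGroup H"
    unfolding G_def by (intro AutoGroup_iso_cong group_presented_group group_H)
  hence "AutoGroup G \<cong> semidirect V \<phi> K" using AutoGroup_H_iso by (rule iso_trans)
  thus ?thesis using psi_hom phi_hom unfolding K_def by blast
qed

end
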